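(* Suppose Assumptions 1 and 2 hold, $Q\succeq0$ satisfies $\mathrm{null}(\Pi_{2u}\Pi_{2u}^\top)\cap\mathrm{null}(Q)=\{0\}$, and $\mu\ge\max\{\hat L_f,L_h\}$. Then for every $\gamma>0$ there exist $\epsilon>0$, $\rho>0$, $\varphi_1,\varphi_2\ge0$ and a matrix $\mathbf P\succ0$ such that $\mathbf A^\gamma_{\epsilon\rho}$ satisfies $\mathrm{LMI}(\mathbf P,\Xi_\varphi)$.
   Context: Let $A\in\mathbb R^{n\times n}$ be Hurwitz, $B\in\mathbb R^{n\times p}$, $B_w\in\mathbb R^{n\times q}$, and for $i=1,2$ let $C_i\in\mathbb R^{r_i\times n}$, $D_{iw}\in\mathbb R^{r_i\times q}$. Define $\Pi_{iu}:=-C_iA^{-1}B$ and $\Pi_{iw}:=-C_iA^{-1}B_w+D_{iw}$. For $t\ge0$ let $f^t:\mathbb R^p\to\mathbb R$, $h^t:\mathbb R^{r_1}\to\mathbb R$ and $g^t:\mathbb R^{r_2}\to\mathbb R\cup\{+\infty\}$ be given, let $w:[0,\infty)\to\mathbb R^q$, and fix $\mu>0$ and $Q\in\mathbb R^{r_2\times r_2}$. Definitions. - $M_{\mu g}(v):=\min_x g(x)+\frac1{2\mu}\|x-v\|^2$ is the Moreau envelope. - $\mathcal P(t)$: minimize $f^t(u)+h^t(y_1)+g^t(y_2)$ subject to $y_i=\Pi_{iu}u+\Pi_{iw}w(t)$. - Its optimal primal-dual pairs are saddle points of $f^t(u)+h^t(\Pi_{1u}u+\Pi_{1w}w(t))+M_{\mu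 g^t}(\Pi_{2u}u+\Pi_{2w}w(t)+\mu\lambda)-\frac\mu2\|\lambda\|^2$. Assumptions. - Assumption 1: for all $t$, $f^t$ is $m$-strongly convex with $L_f$-Lipschitz gradient, $h^t$ is convex with $L_h$-Lipschitz gradient, and $g^t$ is proper, convex and lsc. - Assumption 2: $\mathcal P(t)$ is feasible for all $t\ge0$ and $t\mapsto(u^\star(t),\lambda^\star(t))$ is measurable. Regularized algorithm. For $\gamma>0$ the regularized closed loop is $$\dot x=Ax+Bu+B_ww,\quad \dot u=-\nabla f^t(u)-\Pi_{1u}^\top\nabla h^t(y_1)-\Pi_{2u}^\top\nabla M_{\mu g^t}(y_2+\mu\lambda),\quad \dot\lambda=\mu(\nabla M_{\mu g^t}(y_2+\mu\lambda)-\lambda)-\gamma Q\lambda.$$ Matrices. Let $\hat L_f:=L_f-m$. For $\epsilon>0$ and $\rho\ge0$ define $$\mathbf A^\gamma_\epsilon:=\begin{bmatrix}\frac1\epsilon A&\frac1\epsilon B&0\\0&-mI&0\\0&0&-\mu I-\gamma Q\end{bmatrix},\qquad \mathbf A^\gamma_{\epsilon\rho}:=\mathbf A^\gamma_\epsilon+\rho I,$$ $$\mathbf B=\begin{bmatrix}0&0&0\\-I&-\Pi_{1u}^\top&-\frac1\mu\Pi_{2u}^\top\\0&0&I\end{bmatrix},\qquad \mathbf C=\begin{bmatrix}0&I&0\\C_1&0&0\\C_2&0&\mu I\end{bmatrix}.$$ LMI condition. For $\varphi_1,\varphi_2\ge0$, $\Xi_\varphi$ is the $6\times6$ block matrix,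 with block sizes $(p,r_1,r_2,p,r_1,r_2)$, whose nonzero blocks are: - $(1,4)=(4,1)=\varphi_1\hat L_fI$ and $(4,4)=-2\varphi_1I$; - $(2,5)=(5,2)=\varphi_2L_hI$ and $(5,5)=-2\varphi_2I$; - $(3,6)=(6,3)=I$ and $(6,6)=-2I$. A matrix $\mathbf A'$ satisfies $\mathrm{LMI}(\mathbf P,\Xi_\varphi)$ if $\begin{bmatrix}\mathbf A'^\top\mathbf P+\mathbf P\mathbf A'&\mathbf P\mathbf B\\\mathbf B^\top\mathbf P&0\end{bmatrix}+\begin{bmatrix}\mathbf C^\top&0\\0&I\end{bmatrix}\Xi_\varphi\begin{bmatrix}\mathbf C&0\\0&I\end{bmatrix}\preceq0$. *)

theory Defs
  imports "HOL-Analysis.Analysis"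
begin

section \<open>Matrix notions\<close>

definition psd :: "real^'n^'n \<Rightarrow> bool" where
  "psd M \<longleftrightarrow> transpose M = M \<and> (\<forall>x. 0 \<le> x \<bullet> (M *v x))"

definition pd :: "real^'n^'n \<Rightarrow> bool" where
  "pd M \<longleftrightarrow> transpose M = M \<and> (\<forall>x. x \<noteq> 0 \<longrightarrow> 0 < x \<bullet> (M *v x))"

text \<open>M is negative semidefinite (M \<preceq> 0).\<close>
definition nsd :: "real^'n^'n \<Rightarrow> bool" where
  "nsd M \<longleftrightarrow> psd (- M)"

text \<open>Hurwitz: every (complex) eigenvalue has negative real part.\<close>
definition hurwitz :: "real^'n^'n \<Rightarrow> bool" where
  "hurwitz A \<longleftrightarrow> (\<forall>(l::complex) (v::complex^'n).
      v \<noteq> 0 \<and> (\<chi> i j. complex_of_real (A $ i $ j)) *v v = l *s v \<longrightarrow> Re l < 0)"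

section \<open>Block matrices\<close>

definition block2 ::
  "real^'b1^'a1 \<Rightarrow> real^'b2^'a1 \<Rightarrow> real^'b1^'a2 \<Rightarrow> real^'b2^'a2 \<Rightarrow> real^('b1 + 'b2)^('a1 + 'a2)" where
  "block2 M11 M12 M21 M22 = (\<chi> i j.
     (case i of
        Inl i1 \<Rightarrow> (case j of Inl j1 \<Rightarrow> M11 $ i1 $ j1 | Inr j2 \<Rightarrow> M12 $ i1 $ j2)
      | Inr i2 \<Rightarrow> (case j of Inl j1 \<Rightarrow> M21 $ i2 $ j1 | Inr j2 \<Rightarrow> M22 $ i2 $ j2)))"

definition block3 ::
  "real^'b1^'a1 \<Rightarrow> real^'b2^'a1 \<Rightarrow> real^'b3^'a1 \<Rightarrow>
   real^'b1^'a2 \<Rightarrow> real^'b2^'a2 \<Rightarrow> real^'b3^'a2 \<Rightarrow>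
   real^'b1^'a3 \<Rightarrow> real^'b2^'a3 \<Rightarrow> real^'b3^'a3 \<Rightarrow>
   real^('b1 + 'b2 + 'b3)^('a1 + 'a2 + 'a3)" where
  "block3 M11 M12 M13 M21 M22 M23 M31 M32 M33 = (\<chi> i j.
     (case i of
        Inl i1 \<Rightarrow> (case j of Inl j1 \<Rightarrow> M11 $ i1 $ j1 | Inr (Inl j2) \<Rightarrow> M12 $ i1 $ j2 | Inr (Inr j3) \<Rightarrow> M13 $ i1 $ j3)
      | Inr (Inl i2) \<Rightarrow> (case j of Inl j1 \<Rightarrow> M21 $ i2 $ j1 | Inr (Inl j2) \<Rightarrow> M22 $ i2 $ j2 | Inr (Inr j3) \<Rightarrow> M23 $ i2 $ j3)
      | Inr (Inr i3) \<Rightarrow> (case j of Inl j1 \<Rightarrow> M31 $ i3 $ j1 | Inr (Inl j2) \<Rightarrow> M32 $ i3 $ j2 | Inr (Inr j3) \<Rightarrow> M33 $ i3 $ j3)))"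

section \<open>Matrices of the regularized closed loop\<close>

definition Pi_u :: "real^'n^'r \<Rightarrow> real^'n^'n \<Rightarrow> real^'p^'n \<Rightarrow> real^'p^'r" where
  "Pi_u C A B = - (C ** matrix_inv A ** B)"

definition Pi_w :: "real^'n^'r \<Rightarrow> real^'n^'n \<Rightarrow> real^'q^'n \<Rightarrow> real^'q^'r \<Rightarrow> real^'q^'r" where
  "Pi_w C A Bw D = - (C ** matrix_inv A ** Bw) + D"

text \<open>\<open>A^\<gamma>_\<epsilon>\<close>, state ordered as (x, u, lambda).\<close>
definition AA :: "real^'n^'n \<Rightarrow> real^'p^'n \<Rightarrow> real \<Rightarrow> real \<Rightarrow> real^'r2^'r2 \<Rightarrow> real \<Rightarrow> real \<Rightarrow>
    real^('n + 'p + 'r2)^('n + 'p + 'r2)" where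
  "AA A B m \<mu> Q \<gamma> \<epsilon> = block3
     ((1/\<epsilon>) *\<^sub>R A) ((1/\<epsilon>) *\<^sub>R B) 0
     0 (- (m *\<^sub>R mat 1)) 0
     0 0 (- (\<mu> *\<^sub>R mat 1) - \<gamma> *\<^sub>R Q)"

text \<open>\<open>A^\<gamma>_{\<epsilon>\<rho>} = A^\<gamma>_\<epsilon> + \<rho> I\<close>.\<close>
definition AA_rho :: "real^'n^'n \<Rightarrow> real^'p^'n \<Rightarrow> real \<Rightarrow> real \<Rightarrow> real^'r2^'r2 \<Rightarrow> real \<Rightarrow> real \<Rightarrow> real \<Rightarrow>
    real^('n + 'p + 'r2)^('n + 'p + 'r2)" where
  "AA_rho A B m \<mu> Q \<gamma> \<epsilon> \<rho> = AA A B m \<mu> Q \<gamma> \<epsilon> + \<rho> *\<^sub>R mat 1"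

definition BB :: "real^'p^'r1 \<Rightarrow> real^'p^'r2 \<Rightarrow> real \<Rightarrow> real^('p + 'r1 + 'r2)^('n::finite + 'p + 'r2)" where
  "BB Pi1u Pi2u \<mu> = block3
     0 0 0
     (- mat 1) (- transpose Pi1u) (- ((1/\<mu>) *\<^sub>R transpose Pi2u))
     0 0 (mat 1)"

definition CC :: "real^'n^'r1 \<Rightarrow> real^'n^'r2 \<Rightarrow> real \<Rightarrow> real^('n + 'p::finite + 'r2)^('p + 'r1 + 'r2)" where
  "CC C1 C2 \<mu> = block3
     0 (mat 1) 0
     C1 0 0
     C2 0 (\<mu> *\<^sub>R mat 1)"

text \<open>\<open>\<Xi>_\<phi>\<close> with block sizes (p, r1, r2, p, r1, r2); \<open>Lfh\<close> stands for \<open>L_f - m\<close>.\<close>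
definition Xi :: "real \<Rightarrow> real \<Rightarrow> real \<Rightarrow> real \<Rightarrow>
    real^(('p::finite + 'r1::finite + 'r2::finite) + ('p + 'r1 + 'r2))^(('p + 'r1 + 'r2) + ('p + 'r1 + 'r2))" where
  "Xi Lfh Lh \<phi>1 \<phi>2 = block2
     0
     (block3 ((\<phi>1 * Lfh) *\<^sub>R mat 1) 0 0  0 ((\<phi>2 * Lh) *\<^sub>R mat 1) 0  0 0 (mat 1))
     (block3 ((\<phi>1 * Lfh) *\<^sub>R mat 1) 0 0  0 ((\<phi>2 * Lh) *\<^sub>R mat 1) 0  0 0 (mat 1))
     (block3 ((-2 * \<phi>1) *\<^sub>R mat 1) 0 0  0 ((-2 * \<phi>2) *\<^sub>R mat 1) 0  0 0 ((-2) *\<^sub>R mat 1))"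

text \<open>\<open>A'\<close> satisfies \<open>LMI(P, \<Xi>)\<close> (with the fixed matrices \<open>B\<close>, \<open>C\<close>).\<close>
definition LMI :: "real^'s::finite^'s \<Rightarrow> real^'i^'s \<Rightarrow> real^'s^'o \<Rightarrow> real^'s^'s \<Rightarrow> real^('o + 'i)^('o + 'i) \<Rightarrow> bool" where
  "LMI A' Bm Cm P X \<longleftrightarrow> nsd
     (block2 (transpose A' ** P + P ** A') (P ** Bm) (transpose Bm ** P) 0
      + block2 (transpose Cm) 0 0 (mat 1) ** X ** block2 Cm 0 0 (mat 1))"

section \<open>Function classes (Assumption 1)\<close>

definition strongly_convex :: "real \<Rightarrow> ('a::real_inner \<Rightarrow> real) \<Rightarrow> bool" where
  "strongly_convex m f \<longleftrightarrow> (\<forall>x y a. 0 \<le> a \<and> a \<le> 1 \<longrightarrow>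
     f (a *\<^sub>R x + (1 - a) *\<^sub>R y) \<le> a * f x + (1 - a) * f y - m / 2 * a * (1 - a) * (norm (x - y))\<^sup>2)"

text \<open>f is differentiable with an L-Lipschitz gradient.\<close>
definition lipschitz_gradient :: "real \<Rightarrow> ('a::real_inner \<Rightarrow> real) \<Rightarrow> bool" where
  "lipschitz_gradient L f \<longleftrightarrow> (\<exists>Df. (\<forall>x. (f has_derivative (\<lambda>v. Df x \<bullet> v)) (at x)) \<and> L-lipschitz_on UNIV Df)"

definition ext_convex :: "('a::real_vector \<Rightarrow> ereal) \<Rightarrow> bool" where
  "ext_convex g \<longleftrightarrow> (\<forall>x y a. 0 \<le> a \<and> a \<le> 1 \<longrightarrow>
     g (a *\<^sub>R x + (1 - a) *\<^sub>R y) \<le> ereal a * g x + ereal (1 - a) * g y)"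

definition proper_fun :: "('a \<Rightarrow> ereal) \<Rightarrow> bool" where
  "proper_fun g \<longleftrightarrow> (\<exists>x. g x < \<infinity>) \<and> (\<forall>x. - \<infinity> < g x)"

definition lsc :: "('a::topological_space \<Rightarrow> ereal) \<Rightarrow> bool" where
  "lsc g \<longleftrightarrow> (\<forall>x. g x \<le> Liminf (at x) g)"

section \<open>Optimization problem (Assumption 2)\<close>

text \<open>Moreau envelope \<open>M_{\<mu> g}(v) = min_x g(x) + \<parallel>x - v\<parallel>^2/(2\<mu>)\<close>.\<close>
definition moreau :: "real \<Rightarrow> ('a::real_normed_vector \<Rightarrow> ereal) \<Rightarrow> 'a \<Rightarrow> real" where
  "moreau \<mu> g v = real_of_ereal (INF x. g x + ereal ((norm (x - v))\<^sup>2 / (2 * \<mu>)))"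

text \<open>The saddle function whose saddle points are the optimal primal-dual pairs of \<open>P(t)\<close>.\<close>
definition saddle_fun ::
  "(real \<Rightarrow> real^'p \<Rightarrow> real) \<Rightarrow> (real \<Rightarrow> real^'r1 \<Rightarrow> real) \<Rightarrow> (real \<Rightarrow> real^'r2 \<Rightarrow> ereal) \<Rightarrow>
   (real \<Rightarrow> real^'q) \<Rightarrow> real^'p^'r1 \<Rightarrow> real^'q^'r1 \<Rightarrow> real^'p^'r2 \<Rightarrow> real^'q^'r2 \<Rightarrow> real \<Rightarrow>
   real \<Rightarrow> real^'p \<Rightarrow> real^'r2 \<Rightarrow> real" where
  "saddle_fun f h g w Pi1u Pi1w Pi2u Pi2w \<mu> t u l =
     f t u + h t (Pi1u *v u + Pi1w *v w t)
     + moreau \<mu> (g t) (Pi2u *v u + Pi2w *v w t + \<mu> *\<^sub>R l) - \<mu> / 2 * (norm l)\<^sup>2"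

text \<open>Objective of \<open>P(t)\<close> as a function of u (the constraints eliminate y1, y2).\<close>
definition objective ::
  "(real \<Rightarrow> real^'p \<Rightarrow> real) \<Rightarrow> (real \<Rightarrow> real^'r1 \<Rightarrow> real) \<Rightarrow> (real \<Rightarrow> real^'r2 \<Rightarrow> ereal) \<Rightarrow>
   (real \<Rightarrow> real^'q) \<Rightarrow> real^'p^'r1 \<Rightarrow> real^'q^'r1 \<Rightarrow> real^'p^'r2 \<Rightarrow> real^'q^'r2 \<Rightarrow>
   real \<Rightarrow> real^'p \<Rightarrow> ereal" where
  "objective f h g w Pi1u Pi1w Pi2u Pi2w t u =
     ereal (f t u + h t (Pi1u *v u + Pi1w *v w t)) + g t (Pi2u *v u + Pi2w *v w t)"

text \<open>\<open>P(t)\<close> is feasible: some u gives a finite objective value.\<close>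
definition feasible where
  "feasible f h g w Pi1u Pi1w Pi2u Pi2w t \<longleftrightarrow> (\<exists>u. objective f h g w Pi1u Pi1w Pi2u Pi2w t u < \<infinity>)"

end

(* The plant is exponentially stable, so on the fast time scale its state settles at the
   steady state x = -A^-1 B u, where the algorithm only sees the static maps Pi_1u and Pi_2u.
   The certificate combines a Lyapunov matrix X of A, evaluated at the deviation x + A^-1 B u,
   with the form mu |u|^2 + 2 delta <Pi_2u u, lambda> + mu |lambda|^2 of the reduced
   (quasi-steady-state) system. On the reduced system the LMI form is strictly negative:
   strong convexity, with suitable sector multipliers phi_1 and phi_2, controls u and the inputs
   of the nonlinearities, and for small delta the coupling controls lambda through
   |Pi_2u^T lambda|^2 + gamma lambda^T Q lambda, which is coercive by the kernel condition.
   The remaining terms couple x + A^-1 B u bilinearly to the algorithm variables, so a small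
   time scale epsilon lets the plant dissipation kappa_X / epsilon dominate them, and the margin
   that is left absorbs a small exponential rate rho. *)

theory Submission
  imports Defs "Jordan_Normal_Form.Spectral_Radius"
begin

no_notation vec_index (infixl "$" 100)
no_notation scalar_prod (infix "\<bullet>" 70)
hide_const (open) Matrix.mat

section \<open>Linear algebra on Cartesian matrices\<close>

lemma matrix_transpose_add: "transpose (M + N) = transpose M + transpose (N::real^'n^'m)"
  by (simp add: transpose_def Finite_Cartesian_Product.vec_eq_iff)

lemma transpose_zero [simp]: "transpose (0::real^'n^'m) = 0"
  by (simp add: transpose_def Finite_Cartesian_Product.vec_eq_iff)

lemma matrix_transpose_uminus: "transpose (- M) = - transpose (M::real^'n^'m)"
  by (simp add: transpose_def Finite_Cartesian_Product.vec_eq_iff)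

lemma transpose_sum: "transpose (sum F S) = (\<Sum>k\<in>S. transpose (F k::real^'n^'m))"
  by (induction S rule: infinite_finite_induct) (auto simp: matrix_transpose_add)

lemma matrix_vector_mult_sum: "sum F S *v x = (\<Sum>k\<in>S. F k *v (x::real^'n::finite))"
  by (induction S rule: infinite_finite_induct) (auto simp: matrix_vector_mult_add_rdistrib)

lemma matrix_vector_mult_uminus: "(- M) *v x = - (M *v (x::real^'n::finite))"
  by (simp add: matrix_vector_mult_def Finite_Cartesian_Product.vec_eq_iff sum_negf)

lemma matrix_vector_mult_uminus_right: "M *v (- x) = - (M *v (x::real^'n::finite))"
  by (simp add: matrix_vector_mult_def Finite_Cartesian_Product.vec_eq_iff sum_negf)

lemma scaleR_mat_1_mult [simp]: "(c *\<^sub>R mat 1) *v x = c *\<^sub>R (x::real^'n::finite)"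
  by (metis matrix_vector_mul_lid scaleR_matrix_vector_assoc)

lemma uminus_mat_1_mult [simp]: "(- mat 1) *v x = - (x::real^'n::finite)"
  by (simp add: matrix_vector_mult_uminus)

lemma inner_transpose: "x \<bullet> (transpose N *v y) = (N *v x) \<bullet> (y::real^'m::finite)"
  by (metis dot_lmul_matrix inner_commute transpose_matrix_vector)

lemma inner_vector_matrix: "u \<bullet> (z v* N) = z \<bullet> (N *v (u::real^'n::finite))"
  by (metis dot_lmul_matrix inner_commute)

lemma inner_symmetric_matrix:
  "transpose X = X \<Longrightarrow> x \<bullet> (X *v y) = y \<bullet> (X *v (x::real^'n::finite))"
  by (metis inner_commute inner_transpose)

lemma inner_gram_matrix: "x \<bullet> ((transpose N ** N) *v x) = (norm (N *v (x::real^'n::finite)))\<^sup>2"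
  by (metis inner_transpose matrix_vector_mul_assoc power2_norm_eq_inner)

lemma norm_matrix_vector_le_onorm: "norm (N *v x) \<le> onorm ((*v) N) * norm (x::real^'n::finite)"
  by (simp add: onorm)

lemma norm_matrix_vector_le:
  "onorm ((*v) N) \<le> K \<Longrightarrow> norm (N *v x) \<le> K * norm (x::real^'n::finite)"
  by (meson mult_right_mono norm_ge_zero norm_matrix_vector_le_onorm order_trans)

lemma abs_inner_le_mult: "norm x \<le> \<alpha> \<Longrightarrow> norm y \<le> \<beta> \<Longrightarrow> \<bar>x \<bullet> y\<bar> \<le> \<alpha> * \<beta>"
  for x y :: "'a::real_inner"
  by (meson Cauchy_Schwarz_ineq2 mult_mono norm_ge_zero order_trans)

lemma inner_matrix_le_onorm: "(N *v x) \<bullet> y \<le> onorm ((*v) N) * norm x * norm (y::real^'m::finite)"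
  by (meson Cauchy_Schwarz_ineq2 abs_le_D1 mult_right_mono norm_ge_zero norm_matrix_vector_le_onorm order_trans)

lemma abs_inner_matrix_le_onorm: "\<bar>(N *v x) \<bullet> y\<bar> \<le> onorm ((*v) N) * norm x * norm (y::real^'m::finite)"
  by (meson Cauchy_Schwarz_ineq2 mult_right_mono norm_ge_zero norm_matrix_vector_le_onorm order_trans)

lemma norm_diff4_le: "norm (- a - b - c - d) \<le> norm a + norm b + norm c + norm (d::'a::real_normed_vector)"
  using norm_triangle_ineq4[of "- a - b - c" d] norm_triangle_ineq4[of "- a - b" c]
    norm_triangle_ineq4[of "- a" b]
  by simp

lemma linear_coeff_zero_if_quadratic_nonneg:
  fixes p r :: real
  assumes nonneg: "\<And>t. 0 \<le> 2 * t * p + t\<^sup>2 * r" and r: "0 \<le> r"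
  shows "p = 0"
proof -
  define t where "t = - p / (r + 1)"
  have "0 \<le> (2 * t * p + t\<^sup>2 * r) * (r + 1)\<^sup>2"
    using nonneg[of t] by simp
  also have "\<dots> = 2 * (t * (r + 1)) * p * (r + 1) + (t * (r + 1))\<^sup>2 * r"
    by (simp add: power2_eq_square algebra_simps)
  also have "t * (r + 1) = - p"
    using r by (simp add: t_def)
  also have "2 * (- p) * p * (r + 1) + (- p)\<^sup>2 * r = - p\<^sup>2 * (r + 2)"
    by (simp add: power2_eq_square algebra_simps)
  finally have "p\<^sup>2 * (r + 2) \<le> 0"
    by simp
  then show ?thesis
    using r by (simp add: mult_le_0_iff)
qed

lemma psd_form_eq_0_imp:
  assumes Q: "psd Q" and l: "l \<bullet> (Q *v l) = 0"
  shows "Q *v l = (0::real^'n::finite)"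
proof -
  have sym: "transpose Q = Q" and pos: "\<And>x. 0 \<le> x \<bullet> (Q *v x)"
    using Q unfolding psd_def by auto
  define y where "y = Q *v l"
  have "0 \<le> 2 * t * (y \<bullet> y) + t\<^sup>2 * (y \<bullet> (Q *v y))" for t
  proof -
    have "0 \<le> (l + t *\<^sub>R y) \<bullet> (Q *v (l + t *\<^sub>R y))"
      by (rule pos)
    also have "\<dots> = 2 * t * (y \<bullet> y) + t\<^sup>2 * (y \<bullet> (Q *v y))"
      using l inner_symmetric_matrix[OF sym, of l y]
      by (simp add: y_def inner_commute power2_eq_square algebra_simps)
    finally show ?thesis .
  qed
  then have "y \<bullet> y = 0"
    using linear_coeff_zero_if_quadratic_nonneg pos by blast
  then show ?thesis
    unfolding y_def by simp
qed

lemma psd_gram_coercive: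
  fixes N :: "real^'r::finite^'s::finite" and Q :: "real^'r^'r"
  assumes Q: "psd Q" and kernel: "\<forall>l. N *v l = 0 \<and> Q *v l = 0 \<longrightarrow> l = 0"
  shows "\<exists>\<kappa>>0. \<forall>l. \<kappa> * (norm l)\<^sup>2 \<le> (norm (N *v l))\<^sup>2 + l \<bullet> (Q *v l)"
proof -
  define q where "q l = (norm (N *v l))\<^sup>2 + l \<bullet> (Q *v l)" for l
  have pos: "0 \<le> l \<bullet> (Q *v l)" for l
    using Q unfolding psd_def by auto
  have "continuous_on (sphere 0 1) q"
    unfolding q_def by (intro continuous_intros)
  moreover have "sphere (0::real^'r) 1 \<noteq> {}"
    using vector_choose_size[of 1] by auto
  ultimately obtain l0 where l0: "l0 \<in> sphere 0 1" and min: "\<And>l. l \<in> sphere 0 1 \<Longrightarrow> q l0 \<le> q l"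
    using continuous_attains_inf[OF compact_sphere] by blast
  have "0 < q l0"
  proof (rule ccontr)
    assume "\<not> 0 < q l0"
    then have "(norm (N *v l0))\<^sup>2 = 0" "l0 \<bullet> (Q *v l0) = 0"
      using pos[of l0] zero_le_power2[of "norm (N *v l0)"] unfolding q_def by linarith+
    then have "N *v l0 = 0" "l0 \<bullet> (Q *v l0) = 0"
      by auto
    then have "l0 = 0"
      using kernel psd_form_eq_0_imp[OF Q] by blast
    with l0 show False
      by simp
  qed
  moreover have "q l0 * (norm l)\<^sup>2 \<le> q l" for l
  proof (cases "l = 0")
    case False
    have "q ((1 / norm l) *\<^sub>R l) = (1 / norm l)\<^sup>2 * q l"
      by (simp add: q_def power2_eq_square algebra_simps)
    with min[of "(1 / norm l) *\<^sub>R l"] False show ?thesis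
      by (simp add: field_simps power2_eq_square)
  qed (simp add: q_def)
  ultimately show ?thesis
    unfolding q_def by blast
qed

lemma kernel_transpose_inter_trivial:
  assumes "{x. (N ** transpose N) *v x = 0} \<inter> {x. Q *v x = 0} = {0}"
  shows "\<forall>l. transpose N *v l = 0 \<and> Q *v l = (0::real^'r::finite) \<longrightarrow> l = 0"
proof (intro allI impI)
  fix l
  assume l: "transpose N *v l = 0 \<and> Q *v l = 0"
  then have "(N ** transpose N) *v l = 0"
    by (metis matrix_vector_mul_assoc matrix_vector_mult_0_right)
  with l show "l = 0"
    using assms by blast
qed

section \<open>Stability of Hurwitz matrices\<close>

fun matrix_pow :: "real^'n^'n \<Rightarrow> nat \<Rightarrow> real^'n^'n" where
  "matrix_pow M 0 = mat 1"
| "matrix_pow M (Suc k) = matrix_pow M k ** M"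

lemma matrix_pow_scaleR: "matrix_pow (c *\<^sub>R M) k = (c ^ k) *\<^sub>R matrix_pow M k"
  by (induction k) (simp_all add: matrix_scalar_ac scalar_matrix_assoc[symmetric])

lemma matrix_pow_Suc_mult: "matrix_pow M (Suc k) *v x = matrix_pow M k *v (M *v x)"
  by (simp add: matrix_vector_mul_assoc)

text \<open>The spectral theory of \<open>Jordan_Normal_Form\<close> is applied to a matrix indexed by a finite
  type through the complex \<open>mat\<close> obtained along a fixed enumeration of the index type.\<close>

definition enum_index :: "nat \<Rightarrow> 'n::finite" where
  "enum_index = (SOME f. bij_betw f {..<CARD('n)} UNIV)"

definition enum_pos :: "'n::finite \<Rightarrow> nat" where
  "enum_pos = inv_into {..<CARD('n)} enum_index"

lemma bij_enum_index: "bij_betw enum_index {..<CARD('n)} (UNIV::'n::finite set)"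
proof -
  have "\<exists>f. bij_betw f {..<CARD('n)} (UNIV::'n set)"
    using ex_bij_betw_nat_finite[of "UNIV::'n set"] by (simp add: atLeast0LessThan)
  then show ?thesis
    unfolding enum_index_def by (rule someI_ex)
qed

lemma enum_pos_less: "enum_pos (a::'n::finite) < CARD('n)"
  using bij_enum_index[where 'n='n] inv_into_into[of a enum_index "{..<CARD('n)}"]
  by (auto simp: enum_pos_def bij_betw_def)

lemma enum_index_pos [simp]: "enum_index (enum_pos a) = (a::'n::finite)"
  using bij_enum_index[where 'n='n] by (auto simp: enum_pos_def bij_betw_def f_inv_into_f)

lemma enum_pos_index [simp]: "i < CARD('n) \<Longrightarrow> enum_pos (enum_index i :: 'n::finite) = i"
  using bij_enum_index[where 'n='n] by (auto simp: enum_pos_def bij_betw_def)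

lemma sum_enum_index: "(\<Sum>i<CARD('n). g (enum_index i)) = (\<Sum>a\<in>(UNIV::'n::finite set). g a)"
  using sum.reindex_bij_betw[OF bij_enum_index, of g] .

definition cmat :: "real^'n::finite^'n \<Rightarrow> complex mat" where
  "cmat M = Matrix.mat CARD('n) CARD('n) (\<lambda>(i,j). complex_of_real (M $ enum_index i $ enum_index j))"

definition cvec :: "complex^'n::finite \<Rightarrow> complex vec" where
  "cvec w = vec CARD('n) (\<lambda>i. w $ enum_index i)"

definition complexify :: "real^'n^'m \<Rightarrow> complex^'n^'m" where
  "complexify M = (\<chi> i j. complex_of_real (M $ i $ j))"

lemma cmat_carrier: "cmat (M::real^'n::finite^'n) \<in> carrier_mat CARD('n) CARD('n)"
  by (simp add: cmat_def)

lemma cmat_dim [simp]: "dim_row (cmat (M::real^'n::finite^'n)) = CARD('n)" "dim_col (cmat M) = CARD('n)"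
  by (simp_all add: cmat_def)

lemma cmat_mult: "cmat (M ** N) = cmat M * cmat (N::real^'n::finite^'n)"
proof (rule eq_matI)
  fix i j assume "i < dim_row (cmat M * cmat N)" "j < dim_col (cmat M * cmat N)"
  then have i: "i < CARD('n)" and j: "j < CARD('n)" by (auto simp: cmat_def)
  have "(cmat M * cmat N) $$ (i, j)
      = (\<Sum>k<CARD('n). complex_of_real (M $ enum_index i $ enum_index k * N $ enum_index k $ enum_index j))"
    using i j by (simp add: cmat_def scalar_prod_def atLeast0LessThan)
  also have "\<dots> = (\<Sum>b\<in>UNIV. complex_of_real (M $ enum_index i $ b * N $ b $ enum_index j))"
    by (rule sum_enum_index)
  also have "\<dots> = cmat (M ** N) $$ (i, j)"
    using i j by (simp add: cmat_def matrix_matrix_mult_def)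
  finally show "cmat (M ** N) $$ (i, j) = (cmat M * cmat N) $$ (i, j)" ..
qed (auto simp: cmat_def)

lemma cmat_one: "cmat (mat 1 :: real^'n::finite^'n) = 1\<^sub>m CARD('n)"
proof (rule eq_matI)
  fix i j assume "i < dim_row (1\<^sub>m CARD('n))" "j < dim_col (1\<^sub>m CARD('n))"
  then have i: "i < CARD('n)" and j: "j < CARD('n)" by auto
  then have "enum_index i = (enum_index j :: 'n) \<longleftrightarrow> i = j"
    by (metis enum_pos_index)
  then show "cmat (mat 1 :: real^'n^'n) $$ (i, j) = 1\<^sub>m CARD('n) $$ (i, j)"
    using i j by (simp add: cmat_def Finite_Cartesian_Product.mat_def)
qed (auto simp: cmat_def)

lemma cmat_matrix_pow: "cmat (matrix_pow M k) = cmat (M::real^'n::finite^'n) ^\<^sub>m k"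
  by (induction k) (auto simp: cmat_one cmat_mult cmat_carrier)

lemma cvec_carrier: "cvec (w::complex^'n::finite) \<in> carrier_vec CARD('n)"
  by (simp add: cvec_def)

lemma cvec_index [simp]: "i < CARD('n) \<Longrightarrow> vec_index (cvec w) i = w $ (enum_index i :: 'n::finite)"
  by (simp add: cvec_def)

lemma cvec_inj: "cvec v = cvec w \<longleftrightarrow> v = (w::complex^'n::finite)"
proof
  assume "cvec v = cvec w"
  then have "vec_index (cvec v) (enum_pos a) = vec_index (cvec w) (enum_pos a)" for a :: 'n
    by simp
  then show "v = w"
    by (simp add: enum_pos_less Finite_Cartesian_Product.vec_eq_iff)
qed simp

lemma cvec_zero: "cvec (0::complex^'n::finite) = 0\<^sub>v CARD('n)"
  by (auto simp: cvec_def)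

lemma cvec_eq_zero_iff: "cvec w = 0\<^sub>v CARD('n) \<longleftrightarrow> w = (0::complex^'n::finite)"
  by (metis cvec_inj cvec_zero)

lemma cvec_surj: "v \<in> carrier_vec CARD('n) \<Longrightarrow> \<exists>w::complex^'n::finite. v = cvec w"
  by (intro exI[of _ "\<chi> a. vec_index v (enum_pos a)"]) (auto simp: cvec_def)

lemma cvec_smult: "cvec (l *s w) = l \<cdot>\<^sub>v cvec (w::complex^'n::finite)"
  by (auto simp: cvec_def)

lemma cmat_mult_cvec: "cmat M *\<^sub>v cvec w = cvec (complexify (M::real^'n::finite^'n) *v w)"
proof (rule eq_vecI)
  fix i assume "i < dim_vec (cvec (complexify M *v w))"
  then have i: "i < CARD('n)" by (simp add: cvec_def)
  have "vec_index (cmat M *\<^sub>v cvec w) i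
      = (\<Sum>k<CARD('n). complex_of_real (M $ enum_index i $ enum_index k) * w $ enum_index k)"
    using i by (simp add: cmat_def cvec_def scalar_prod_def atLeast0LessThan)
  also have "\<dots> = (\<Sum>b\<in>UNIV. complex_of_real (M $ enum_index i $ b) * w $ b)"
    by (rule sum_enum_index)
  also have "\<dots> = vec_index (cvec (complexify M *v w)) i"
    using i by (simp add: cvec_def complexify_def matrix_vector_mult_def)
  finally show "vec_index (cmat M *\<^sub>v cvec w) i = vec_index (cvec (complexify M *v w)) i" .
qed (simp add: cmat_def cvec_def)

lemma spectrum_cmat_iff:
  "l \<in> spectrum (cmat M) \<longleftrightarrow> (\<exists>w. w \<noteq> 0 \<and> complexify (M::real^'n::finite^'n) *v w = l *s w)"
proof -
  have "l \<in> spectrum (cmat M) \<longleftrightarrow>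
      (\<exists>v \<in> carrier_vec CARD('n). v \<noteq> 0\<^sub>v CARD('n) \<and> cmat M *\<^sub>v v = l \<cdot>\<^sub>v v)"
    by (auto simp: spectrum_def eigenvalue_def eigenvector_def)
  also have "\<dots> \<longleftrightarrow> (\<exists>w::complex^'n. cvec w \<noteq> 0\<^sub>v CARD('n) \<and> cmat M *\<^sub>v cvec w = l \<cdot>\<^sub>v cvec w)"
  proof
    assume "\<exists>v \<in> carrier_vec CARD('n). v \<noteq> 0\<^sub>v CARD('n) \<and> cmat M *\<^sub>v v = l \<cdot>\<^sub>v v"
    then obtain v where "v \<in> carrier_vec CARD('n)" "v \<noteq> 0\<^sub>v CARD('n)" "cmat M *\<^sub>v v = l \<cdot>\<^sub>v v"
      by blast
    moreover obtain w :: "complex^'n" where "v = cvec w"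
      using cvec_surj \<open>v \<in> carrier_vec CARD('n)\<close> by blast
    ultimately show "\<exists>w::complex^'n. cvec w \<noteq> 0\<^sub>v CARD('n) \<and> cmat M *\<^sub>v cvec w = l \<cdot>\<^sub>v cvec w"
      by blast
  next
    assume "\<exists>w::complex^'n. cvec w \<noteq> 0\<^sub>v CARD('n) \<and> cmat M *\<^sub>v cvec w = l \<cdot>\<^sub>v cvec w"
    then show "\<exists>v \<in> carrier_vec CARD('n). v \<noteq> 0\<^sub>v CARD('n) \<and> cmat M *\<^sub>v v = l \<cdot>\<^sub>v v"
      using cvec_carrier by blast
  qed
  also have "\<dots> \<longleftrightarrow> (\<exists>w::complex^'n. w \<noteq> 0 \<and> cvec (complexify M *v w) = cvec (l *s w))"
    by (simp only: cvec_eq_zero_iff cmat_mult_cvec cvec_smult)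
  also have "\<dots> \<longleftrightarrow> (\<exists>w. w \<noteq> 0 \<and> complexify M *v w = l *s w)"
    by (simp add: cvec_inj)
  finally show ?thesis .
qed

lemma hurwitz_spectrum_Re_neg: "hurwitz A \<Longrightarrow> l \<in> spectrum (cmat A) \<Longrightarrow> Re l < 0"
  unfolding spectrum_cmat_iff hurwitz_def complexify_def by blast

lemma complexify_affine_mult:
  "complexify (a *\<^sub>R mat 1 + b *\<^sub>R M) *v w
     = of_real a *s w + of_real b *s (complexify (M::real^'n::finite^'n) *v w)"
proof -
  have entry: "complex_of_real ((a *\<^sub>R mat 1 + b *\<^sub>R M) $ i $ j) * w $ j
      = (if j = i then of_real a * w $ j else 0) + of_real b * (of_real (M $ i $ j) * w $ j)" for i j
    by (simp add: Finite_Cartesian_Product.mat_def algebra_simps)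
  show ?thesis
    unfolding Finite_Cartesian_Product.vec_eq_iff matrix_vector_mult_def complexify_def vec_lambda_beta entry
    by (simp add: sum.distrib sum_distrib_left)
qed

lemma spectrum_cmat_affine:
  assumes \<nu>: "\<nu> \<in> spectrum (cmat (a *\<^sub>R mat 1 + b *\<^sub>R M))" and b: "b \<noteq> 0"
  shows "(\<nu> - of_real a) / of_real b \<in> spectrum (cmat (M::real^'n::finite^'n))"
proof -
  obtain w where w: "w \<noteq> 0" and eq: "complexify (a *\<^sub>R mat 1 + b *\<^sub>R M) *v w = \<nu> *s w"
    using \<nu> by (auto simp: spectrum_cmat_iff)
  have "complexify M *v w = ((\<nu> - of_real a) / of_real b) *s w"
  proof -
    have "of_real a * w $ i + of_real b * (complexify M *v w) $ i = \<nu> * w $ i" for i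
      using arg_cong[OF eq, of "\<lambda>v. v $ i"] by (simp add: complexify_affine_mult)
    then show ?thesis
      using b by (simp add: Finite_Cartesian_Product.vec_eq_iff field_simps)
  qed
  with w show ?thesis
    by (auto simp: spectrum_cmat_iff)
qed

lemma norm_le_spectral_radius_cmat:
  "\<nu> \<in> spectrum (cmat M) \<Longrightarrow> cmod \<nu> \<le> spectral_radius (cmat (M::real^'n::finite^'n))"
  using spectral_radius_mem_max(2)[OF cmat_carrier] by auto

lemma spectral_radius_cmat_less_1:
  assumes "\<And>\<nu>. \<nu> \<in> spectrum (cmat M) \<Longrightarrow> cmod \<nu> < 1"
  shows "spectral_radius (cmat (M::real^'n::finite^'n)) < 1"
  using spectral_radius_mem_max(1)[OF cmat_carrier[of M]] assms by auto

lemma cmod_one_plus_mult_less_1: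
  fixes l :: complex
  assumes Re: "Re l < 0" and h: "0 < h" "h \<le> - Re l / (cmod l)\<^sup>2"
  shows "cmod (1 + of_real h * l) < 1"
proof -
  have pos: "0 < (cmod l)\<^sup>2"
    using Re by auto
  have "h * (cmod l)\<^sup>2 \<le> (- Re l / (cmod l)\<^sup>2) * (cmod l)\<^sup>2"
    using h(2) by (intro mult_right_mono) auto
  also have "\<dots> = - Re l"
    using pos by simp
  finally have "h * (h * (cmod l)\<^sup>2) \<le> h * (- Re l)"
    using h(1) by (intro mult_left_mono) auto
  moreover have "(cmod (1 + of_real h * l))\<^sup>2 = 1 + 2 * h * Re l + h * (h * (cmod l)\<^sup>2)"
    by (simp only: cmod_power2) (simp add: power2_eq_square algebra_simps)
  moreover have "h * Re l < 0"
    using h Re by (simp add: mult_pos_neg)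
  ultimately have "(cmod (1 + of_real h * l))\<^sup>2 < 1"
    by linarith
  then show ?thesis
    by (simp add: power_less_one_iff abs_square_less_1)
qed

text \<open>The explicit Euler step \<open>I + h A\<close> of a Hurwitz matrix is a discrete-time stable matrix
  once \<open>h\<close> is small compared with \<open>-Re \<lambda> / |\<lambda>|\<^sup>2\<close> for all eigenvalues \<open>\<lambda>\<close> of \<open>A\<close>.\<close>

lemma hurwitz_euler_spectral_radius:
  assumes "hurwitz (A::real^'n::finite^'n)"
  shows "\<exists>h>0. spectral_radius (cmat (mat 1 + h *\<^sub>R A)) < 1"
proof -
  define S where "S = spectrum (cmat A)"
  have fin: "finite S"
    unfolding S_def by (rule card_finite_spectrum(1)[OF cmat_carrier])
  have Re: "Re l < 0" if "l \<in> S" for l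
    using hurwitz_spectrum_Re_neg[OF assms] that unfolding S_def by blast
  define h where "h = Min (insert 1 ((\<lambda>l. - Re l / (cmod l)\<^sup>2) ` S))"
  have "0 < - Re l / (cmod l)\<^sup>2" if "l \<in> S" for l
  proof (rule divide_pos_pos)
    show "0 < - Re l" "0 < (cmod l)\<^sup>2"
      using Re[OF that] by auto
  qed
  then have h_pos: "0 < h"
    unfolding h_def using fin by auto
  have h_le: "h \<le> - Re l / (cmod l)\<^sup>2" if "l \<in> S" for l
    unfolding h_def using fin that by (intro Min_le) auto
  have "cmod \<nu> < 1" if "\<nu> \<in> spectrum (cmat (mat 1 + h *\<^sub>R A))" for \<nu>
  proof -
    have "(\<nu> - 1) / of_real h \<in> S"
      using spectrum_cmat_affine[of \<nu> 1 h A] that h_pos unfolding S_def by simp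
    moreover have "\<nu> = 1 + of_real h * ((\<nu> - 1) / of_real h)"
      using h_pos by simp
    ultimately show ?thesis
      using cmod_one_plus_mult_less_1 Re h_le h_pos by metis
  qed
  then show ?thesis
    using h_pos spectral_radius_cmat_less_1 by blast
qed

lemma matrix_pow_entries_decay:
  assumes "spectral_radius (cmat M) < 1"
  shows "\<exists>c \<rho>. 0 < \<rho> \<and> \<rho> < 1 \<and> (\<forall>k a b. \<bar>matrix_pow (M::real^'n::finite^'n) k $ a $ b\<bar> \<le> c * \<rho> ^ k)"
proof -
  define r where "r = spectral_radius (cmat M)"
  have "0 \<le> r"
    using spectral_radius_mem_max(1)[OF cmat_carrier, of M] unfolding r_def by auto
  define \<rho> where "\<rho> = (1 + r) / 2"
  have \<rho>: "0 < \<rho>" "\<rho> < 1" "r < \<rho>"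
    using \<open>0 \<le> r\<close> assms unfolding \<rho>_def r_def by auto
  define M' where "M' = (1 / \<rho>) *\<^sub>R M"
  have "cmod \<nu> < 1" if "\<nu> \<in> spectrum (cmat M')" for \<nu>
  proof -
    have "(\<nu> - 0) / of_real (1 / \<rho>) \<in> spectrum (cmat M)"
      using spectrum_cmat_affine[of \<nu> 0 "1 / \<rho>" M] that \<rho> unfolding M'_def by simp
    moreover have "(\<nu> - 0) / of_real (1 / \<rho>) = of_real \<rho> * \<nu>"
      using \<rho> by (simp add: field_simps)
    ultimately have "cmod (of_real \<rho> * \<nu>) \<le> r"
      unfolding r_def by (metis norm_le_spectral_radius_cmat)
    then have "\<rho> * cmod \<nu> \<le> r"
      using \<rho> by (simp add: norm_mult)
    then have "\<rho> * cmod \<nu> < \<rho> * 1"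
      using \<rho>(3) by linarith
    then show ?thesis
      using \<rho> by (simp only: mult_less_cancel_left_pos)
  qed
  then obtain c where c: "\<And>k. norm_bound (cmat M' ^\<^sub>m k) c"
    using spectral_radius_jnf_norm_bound_less_1_upper_triangular[OF cmat_carrier spectral_radius_cmat_less_1]
    by blast
  have "\<bar>matrix_pow M k $ a $ b\<bar> \<le> c * \<rho> ^ k" for k a b
  proof -
    have "norm (cmat (matrix_pow M' k) $$ (enum_pos a, enum_pos b)) \<le> c"
      using c[of k] enum_pos_less[of a] enum_pos_less[of b]
      unfolding cmat_matrix_pow[symmetric] norm_bound_def by simp
    moreover have "cmat (matrix_pow M' k) $$ (enum_pos a, enum_pos b)
        = complex_of_real ((1 / \<rho>) ^ k * matrix_pow M k $ a $ b)"
      using enum_pos_less[of a] enum_pos_less[of b]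
      by (simp add: cmat_def M'_def matrix_pow_scaleR del: of_real_mult of_real_power of_real_divide)
    ultimately have "(1 / \<rho>) ^ k * \<bar>matrix_pow M k $ a $ b\<bar> \<le> c"
      using \<rho> by (simp only: norm_of_real abs_mult) simp
    then show ?thesis
      using \<rho> by (simp add: field_simps)
  qed
  with \<rho> show ?thesis
    by blast
qed

lemma matrix_pow_eventually_halves:
  assumes entries: "\<And>k a b. \<bar>matrix_pow (M::real^'n::finite^'n) k $ a $ b\<bar> \<le> c * \<rho> ^ k"
    and \<rho>: "0 < \<rho>" "\<rho> < 1"
  shows "\<exists>K>0. \<forall>x. norm (matrix_pow M K *v x) \<le> norm x / 2"
proof -
  define C where "C = real CARD('n) * real CARD('n) * \<bar>c\<bar> + 1"
  have C: "0 < C"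
    unfolding C_def by (simp add: add_nonneg_pos)
  obtain K0 where K0: "\<rho> ^ K0 < 1 / (2 * C)"
    using real_arch_pow_inv[of "1 / (2 * C)" \<rho>] \<rho> C by auto
  have "onorm ((*v) (matrix_pow M (Suc K0))) \<le> real CARD('n) * real CARD('n) * (c * \<rho> ^ Suc K0)"
    by (rule onorm_le_matrix_component[OF entries])
  also have "\<dots> \<le> real CARD('n) * real CARD('n) * (\<bar>c\<bar> * \<rho> ^ K0)"
    using \<rho> by (intro mult_left_mono mult_mono) (auto simp: power_decreasing)
  also have "\<dots> \<le> C * \<rho> ^ K0"
    unfolding C_def using \<rho> by (simp add: algebra_simps)
  also have "\<dots> \<le> 1 / 2"
    using K0 C by (simp add: field_simps)
  finally have "norm (matrix_pow M (Suc K0) *v x) \<le> norm x / 2" for x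
    using norm_matrix_vector_le by fastforce
  then show ?thesis
    by blast
qed

text \<open>Discrete Lyapunov (Stein) certificate: \<open>X = \<Sum>k<K. (M\<^sup>k)\<^sup>T M\<^sup>k\<close> decreases along \<open>M\<close>
  because the sum telescopes and \<open>M\<^sup>K\<close> halves every vector.\<close>

lemma stein_certificate:
  assumes K: "0 < K" and halves: "\<And>x. norm (matrix_pow M K *v x) \<le> norm x / 2"
  shows "\<exists>X. transpose X = X \<and> (\<forall>x. (norm x)\<^sup>2 \<le> x \<bullet> (X *v x))
    \<and> (\<forall>x. (M *v x) \<bullet> (X *v (M *v x)) \<le> x \<bullet> (X *v x) - 3 / 4 * (norm (x::real^'n::finite))\<^sup>2)"
proof (intro exI conjI allI)
  define X where "X = (\<Sum>k<K. transpose (matrix_pow M k) ** matrix_pow M k)"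
  show "transpose X = X"
    unfolding X_def transpose_sum by (simp add: matrix_transpose_mul)
  have form: "x \<bullet> (X *v x) = (\<Sum>k<K. (norm (matrix_pow M k *v x))\<^sup>2)" for x
    unfolding X_def matrix_vector_mult_sum inner_sum_right inner_gram_matrix ..
  fix x
  have "(norm x)\<^sup>2 = (norm (matrix_pow M 0 *v x))\<^sup>2"
    by simp
  also have "\<dots> \<le> (\<Sum>k<K. (norm (matrix_pow M k *v x))\<^sup>2)"
    by (rule member_le_sum) (use K in auto)
  finally show "(norm x)\<^sup>2 \<le> x \<bullet> (X *v x)"
    unfolding form .
  have "(M *v x) \<bullet> (X *v (M *v x)) + (norm x)\<^sup>2 = x \<bullet> (X *v x) + (norm (matrix_pow M K *v x))\<^sup>2"
    unfolding form matrix_pow_Suc_mult[symmetric]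
    using sum.lessThan_Suc_shift[of "\<lambda>k. (norm (matrix_pow M k *v x))\<^sup>2" K] by simp
  moreover have "(norm (matrix_pow M K *v x))\<^sup>2 \<le> (norm x / 2)\<^sup>2"
    using halves[of x] by (simp add: power_mono)
  ultimately show "(M *v x) \<bullet> (X *v (M *v x)) \<le> x \<bullet> (X *v x) - 3 / 4 * (norm x)\<^sup>2"
    by (simp add: power_divide)
qed

lemma hurwitz_lyapunov:
  assumes "hurwitz (A::real^'n::finite^'n)"
  shows "\<exists>X \<kappa>. transpose X = X \<and> 0 < \<kappa> \<and> (\<forall>x. (norm x)\<^sup>2 \<le> x \<bullet> (X *v x))
    \<and> (\<forall>x. x \<bullet> (X *v (A *v x)) \<le> - \<kappa> * (norm x)\<^sup>2)"
proof -
  obtain h where h: "0 < h" and sr: "spectral_radius (cmat (mat 1 + h *\<^sub>R A)) < 1"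
    using hurwitz_euler_spectral_radius[OF assms] by blast
  define M where "M = mat 1 + h *\<^sub>R A"
  obtain c \<rho> where "0 < \<rho>" "\<rho> < 1" "\<And>k a b. \<bar>matrix_pow M k $ a $ b\<bar> \<le> c * \<rho> ^ k"
    using matrix_pow_entries_decay[OF sr] unfolding M_def by blast
  then obtain K where "0 < K" "\<And>x. norm (matrix_pow M K *v x) \<le> norm x / 2"
    using matrix_pow_eventually_halves by blast
  then obtain X where X: "transpose X = X" "\<And>x. (norm x)\<^sup>2 \<le> x \<bullet> (X *v x)"
    "\<And>x. (M *v x) \<bullet> (X *v (M *v x)) \<le> x \<bullet> (X *v x) - 3 / 4 * (norm x)\<^sup>2"
    using stein_certificate by blast
  have "x \<bullet> (X *v (A *v x)) \<le> - (3 / (8 * h)) * (norm x)\<^sup>2" for x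
  proof -
    have "(M *v x) \<bullet> (X *v (M *v x))
        = x \<bullet> (X *v x) + 2 * h * (x \<bullet> (X *v (A *v x))) + h\<^sup>2 * ((A *v x) \<bullet> (X *v (A *v x)))"
      using inner_symmetric_matrix[OF X(1), of "A *v x" x]
      by (simp add: M_def scaleR_matrix_vector_assoc[symmetric] power2_eq_square algebra_simps)
    moreover have "0 \<le> h\<^sup>2 * ((A *v x) \<bullet> (X *v (A *v x)))"
      using X(2)[of "A *v x"] by (simp add: order_trans[OF zero_le_power2])
    ultimately have "2 * h * (x \<bullet> (X *v (A *v x))) \<le> - 3 / 4 * (norm x)\<^sup>2"
      using X(3)[of x] by linarith
    then show ?thesis
      using h by (simp add: field_simps)
  qed
  with X h show ?thesis
    by (intro exI[of _ X] exI[of _ "3 / (8 * h)"]) auto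
qed

lemma hurwitz_right_inverse:
  assumes "hurwitz (A::real^'n::finite^'n)"
  shows "A ** matrix_inv A = mat 1"
proof -
  have "x = 0" if "A *v x = 0" for x
  proof (rule ccontr)
    assume "x \<noteq> 0"
    then have "(\<chi> i. complex_of_real (x $ i)) \<noteq> 0"
      by (simp add: Finite_Cartesian_Product.vec_eq_iff)
    moreover have "(\<chi> i j. complex_of_real (A $ i $ j)) *v (\<chi> i. complex_of_real (x $ i)) = 0 *s (\<chi> i. complex_of_real (x $ i))"
      using that by (simp add: Finite_Cartesian_Product.vec_eq_iff matrix_vector_mult_def flip: of_real_sum of_real_mult)
    ultimately show False
      using assms unfolding hurwitz_def by fastforce
  qed
  then have "invertible A"
    using matrix_left_invertible_ker invertible_left_inverse by blast
  then have "A ** matrix_inv A = mat 1 \<and> matrix_inv A ** A = mat 1"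
    unfolding invertible_def matrix_inv_def by (rule someI_ex)
  then show ?thesis ..
qed

section \<open>Block vectors and the LMI\<close>

definition join_vec :: "real^'a::finite \<Rightarrow> real^'b::finite \<Rightarrow> real^('a + 'b)" where
  "join_vec x y = (\<chi> i. case i of Inl a \<Rightarrow> x $ a | Inr b \<Rightarrow> y $ b)"

lemma join_vec_Inl [simp]: "join_vec x y $ Inl a = x $ a"
  and join_vec_Inr [simp]: "join_vec x y $ Inr b = y $ b"
  by (simp_all add: join_vec_def)

lemma sum_UNIV_Plus:
  "(\<Sum>i\<in>(UNIV::('a::finite + 'b::finite) set). g i) = (\<Sum>a\<in>UNIV. g (Inl a)) + (\<Sum>b\<in>UNIV. g (Inr b))"
  by (simp flip: UNIV_Plus_UNIV add: sum.Plus comp_def)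

lemma inner_join_vec [simp]: "join_vec x y \<bullet> join_vec x' y' = x \<bullet> x' + y \<bullet> y'"
  by (simp add: inner_vec_def sum_UNIV_Plus)

lemma join_vec_zero [simp]: "join_vec (0::real^'a::finite) (0::real^'b::finite) = 0"
  by (auto simp: Finite_Cartesian_Product.vec_eq_iff join_vec_def split: sum.split)

lemma join_vec_cases:
  obtains x y where "z = join_vec x y"
proof
  show "z = join_vec (\<chi> a. z $ Inl a) (\<chi> b. z $ Inr b)"
    by (auto simp: Finite_Cartesian_Product.vec_eq_iff join_vec_def split: sum.split)
qed

lemma block2_mult_join_vec:
  "block2 M11 M12 M21 M22 *v join_vec x y = join_vec (M11 *v x + M12 *v y) (M21 *v x + M22 *v y)"
  by (auto simp: Finite_Cartesian_Product.vec_eq_iff block2_def join_vec_def matrix_vector_mult_def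
      sum_UNIV_Plus split: sum.split)

lemma block3_mult_join_vec:
  "block3 M11 M12 M13 M21 M22 M23 M31 M32 M33 *v join_vec x (join_vec y z) =
   join_vec (M11 *v x + M12 *v y + M13 *v z)
     (join_vec (M21 *v x + M22 *v y + M23 *v z) (M31 *v x + M32 *v y + M33 *v z))"
  by (auto simp: Finite_Cartesian_Product.vec_eq_iff block3_def join_vec_def matrix_vector_mult_def
      sum_UNIV_Plus split: sum.split)

lemma transpose_block2:
  "transpose (block2 M11 M12 M21 M22) = block2 (transpose M11) (transpose M21) (transpose M12) (transpose M22)"
  by (simp add: Finite_Cartesian_Product.vec_eq_iff block2_def transpose_def split: sum.split)

lemma transpose_block3:
  "transpose (block3 M11 M12 M13 M21 M22 M23 M31 M32 M33) =
   block3 (transpose M11) (transpose M21) (transpose M31) (transpose M12) (transpose M22) (transpose M32)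
     (transpose M13) (transpose M23) (transpose M33)"
  by (simp add: Finite_Cartesian_Product.vec_eq_iff block3_def transpose_def split: sum.split)

lemma LMI_of_quadratic_form:
  fixes A' P :: "real^'s::finite^'s" and Bm :: "real^'i::finite^'s" and Cm :: "real^'s^'o::finite"
    and X :: "real^('o + 'i)^('o + 'i)"
  assumes P: "transpose P = P" and X: "transpose X = X"
    and form: "\<And>\<xi> \<zeta>. 2 * ((P *v \<xi>) \<bullet> (A' *v \<xi> + Bm *v \<zeta>))
      + join_vec (Cm *v \<xi>) \<zeta> \<bullet> (X *v join_vec (Cm *v \<xi>) \<zeta>) \<le> 0"
  shows "LMI A' Bm Cm P X"
proof -
  define N :: "real^('s + 'i)^('o + 'i)" where "N = block2 Cm 0 0 (mat 1)"
  define L where "L = block2 (transpose A' ** P + P ** A') (P ** Bm) (transpose Bm ** P) 0 + transpose N ** X ** N"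
  have L: "block2 (transpose A' ** P + P ** A') (P ** Bm) (transpose Bm ** P) 0
      + block2 (transpose Cm) 0 0 (mat 1) ** X ** block2 Cm 0 0 (mat 1) = L"
    unfolding L_def N_def transpose_block2 by simp
  have "transpose L = L"
    unfolding L_def matrix_transpose_add transpose_block2 matrix_transpose_mul transpose_transpose P X
    by (simp add: matrix_mul_assoc add.commute)
  moreover have "z \<bullet> (L *v z) \<le> 0" for z
  proof -
    obtain \<xi> \<zeta> where z: "z = join_vec \<xi> \<zeta>"
      using join_vec_cases by blast
    have "z \<bullet> (L *v z) = \<xi> \<bullet> ((transpose A' ** P) *v \<xi>) + \<xi> \<bullet> ((P ** A') *v \<xi>) + \<xi> \<bullet> ((P ** Bm) *v \<zeta>)
        + \<zeta> \<bullet> ((transpose Bm ** P) *v \<xi>) + (N *v z) \<bullet> (X *v (N *v z))"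
      by (simp add: L_def z block2_mult_join_vec matrix_vector_mult_add_rdistrib inner_add_right
          inner_vector_matrix inner_commute matrix_mul_assoc flip: matrix_vector_mul_assoc)
    also have "\<dots> = 2 * ((P *v \<xi>) \<bullet> (A' *v \<xi> + Bm *v \<zeta>)) + join_vec (Cm *v \<xi>) \<zeta> \<bullet> (X *v join_vec (Cm *v \<xi>) \<zeta>)"
      using inner_symmetric_matrix[OF P, of \<xi> "A' *v \<xi>"] inner_symmetric_matrix[OF P, of \<xi> "Bm *v \<zeta>"]
      by (simp add: N_def z block2_mult_join_vec inner_vector_matrix inner_add_right inner_commute
          flip: matrix_vector_mul_assoc)
    finally show ?thesis
      using form by simp
  qed
  ultimately show ?thesis
    unfolding LMI_def nsd_def psd_def L
    by (simp add: matrix_transpose_uminus matrix_vector_mult_uminus)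
qed

section \<open>Scalar estimates\<close>

lemma mult_le_sq_div_add_sq: "0 < t \<Longrightarrow> p * q \<le> p\<^sup>2 / (4 * t) + t * q\<^sup>2" for p q t :: real
proof -
  assume t: "0 < t"
  have "0 \<le> (p - 2 * t * q)\<^sup>2"
    by simp
  then have "4 * t * (p * q) \<le> 4 * t * (p\<^sup>2 / (4 * t) + t * q\<^sup>2)"
    using t by (simp add: power2_eq_square algebra_simps)
  then show ?thesis
    using t by simp
qed

lemma square_sum4_le: "(a + b + c + d)\<^sup>2 \<le> 4 * (a\<^sup>2 + b\<^sup>2 + c\<^sup>2 + d\<^sup>2)" for a b c d :: real
proof -
  have "0 \<le> (a - b)\<^sup>2 + (a - c)\<^sup>2 + (a - d)\<^sup>2 + (b - c)\<^sup>2 + (b - d)\<^sup>2 + (c - d)\<^sup>2"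
    by simp
  then show ?thesis
    by (simp add: power2_eq_square algebra_simps)
qed

lemma neg_mult_le_of_abs_le: "\<bar>t\<bar> \<le> c \<Longrightarrow> 0 \<le> k \<Longrightarrow> - (k * t) \<le> k * c" for t c k :: real
  by (metis abs_le_iff minus_mult_right mult_left_mono)

lemma mult_le_abs_mult_of_abs_le: "\<bar>t\<bar> \<le> c \<Longrightarrow> k * t \<le> \<bar>k\<bar> * c" for t c k :: real
  by (metis abs_ge_self abs_ge_zero abs_mult mult_left_mono order_trans)

lemma sum_norms_shift_le:
  "(norm u)\<^sup>2 + (norm l)\<^sup>2 + (norm z1)\<^sup>2 + (norm z2)\<^sup>2 + (norm (e + c *\<^sub>R l))\<^sup>2
    \<le> (2 + 2 * c\<^sup>2) * ((norm u)\<^sup>2 + (norm l)\<^sup>2 + (norm z1)\<^sup>2 + (norm z2)\<^sup>2 + (norm e)\<^sup>2)"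
  for u :: "'a::real_normed_vector" and z1 :: "'b::real_normed_vector"
    and z2 :: "'c::real_normed_vector" and l e :: "'d::real_normed_vector"
proof -
  define W where "W = (norm u)\<^sup>2 + (norm l)\<^sup>2 + (norm z1)\<^sup>2 + (norm z2)\<^sup>2 + (norm e)\<^sup>2"
  have "(norm (e + c *\<^sub>R l))\<^sup>2 \<le> (norm e + \<bar>c\<bar> * norm l)\<^sup>2"
    using norm_triangle_ineq[of e "c *\<^sub>R l"] by (simp add: power_mono)
  also have "\<dots> \<le> 2 * (norm e)\<^sup>2 + 2 * (c\<^sup>2 * (norm l)\<^sup>2)"
    using sum_squares_bound[of "norm e" "\<bar>c\<bar> * norm l"] by (simp add: power2_sum power_mult_distrib)
  finally have shift: "(norm (e + c *\<^sub>R l))\<^sup>2 \<le> 2 * (norm e)\<^sup>2 + 2 * (c\<^sup>2 * (norm l)\<^sup>2)" .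
  have "c\<^sup>2 * (norm l)\<^sup>2 \<le> c\<^sup>2 * W"
    by (rule mult_left_mono) (simp_all add: W_def)
  then have "(norm u)\<^sup>2 + (norm l)\<^sup>2 + (norm z1)\<^sup>2 + (norm z2)\<^sup>2 + (norm (e + c *\<^sub>R l))\<^sup>2 \<le> 2 * W + 2 * (c\<^sup>2 * W)"
    using shift W_def zero_le_power2[of "norm u"] zero_le_power2[of "norm l"] zero_le_power2[of "norm z1"]
      zero_le_power2[of "norm z2"]
    by linarith
  also have "\<dots> = (2 + 2 * c\<^sup>2) * W"
    by (simp add: algebra_simps)
  finally show ?thesis
    unfolding W_def .
qed

lemma exists_pos_le_mult_le:
  fixes a b c :: real
  assumes "0 < a" "0 < b" "0 \<le> c"
  shows "\<exists>\<delta>>0. \<delta> \<le> a \<and> \<delta> * c \<le> b"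
proof (intro exI conjI)
  show "0 < min a (b / (c + 1))" "min a (b / (c + 1)) \<le> a"
    using assms by simp_all
  have "min a (b / (c + 1)) * c \<le> b / (c + 1) * c"
    using assms by (intro mult_right_mono) auto
  also have "\<dots> \<le> b"
    using assms by (simp add: field_simps)
  finally show "min a (b / (c + 1)) * c \<le> b" .
qed

text \<open>With \<open>\<phi>' < \<phi>\<close>, the inequality below lets \<open>\<mu> M b\<^sup>2 + \<phi>' s\<^sup>2\<close> absorb the cross term
  \<open>(\<phi> L - \<mu>) b s\<close> and leaves \<open>\<phi> - \<phi>' > 0\<close> in front of \<open>s\<^sup>2\<close>.\<close>

lemma sector_multiplier_exists:
  fixes \<mu> M L :: real
  assumes \<mu>: "0 < \<mu>" and M: "0 < M" and L: "- M < L"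
  shows "\<exists>\<phi> \<phi>'. 0 < \<phi>' \<and> \<phi>' < \<phi> \<and> (\<phi> * L - \<mu>)\<^sup>2 < 4 * \<phi>' * \<mu> * M"
proof -
  obtain \<phi> where \<phi>: "0 < \<phi>" "(\<phi> * L - \<mu>)\<^sup>2 < 4 * \<phi> * \<mu> * M"
  proof (cases "0 < L")
    case True
    then show ?thesis
      using \<mu> M by (intro that[of "\<mu> / L"]) (auto simp: field_simps)
  next
    case False
    define d where "d = M - L"
    have d: "0 < d"
      using False M by (simp add: d_def)
    have "(9 * L - 7 * M) * (L + M) < 0"
      using False L M by (intro mult_neg_pos) auto
    then have "(3 * L - M)\<^sup>2 < 8 * M * d"
      by (simp add: d_def power2_eq_square algebra_simps)
    then have "\<mu>\<^sup>2 * (3 * L - M)\<^sup>2 / d\<^sup>2 < \<mu>\<^sup>2 * (8 * M * d) / d\<^sup>2"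
      using \<mu> d by (intro divide_strict_right_mono mult_strict_left_mono) auto
    moreover have "2 * \<mu> / d * L - \<mu> = \<mu> * (3 * L - M) / d"
      using d by (simp add: d_def field_simps)
    moreover have "\<mu>\<^sup>2 * (8 * M * d) / d\<^sup>2 = 4 * (2 * \<mu> / d) * \<mu> * M"
      using d by (simp add: field_simps power2_eq_square)
    ultimately show ?thesis
      using \<mu> d by (intro that[of "2 * \<mu> / d"]) (auto simp: power_divide power_mult_distrib)
  qed
  define q where "q = (\<phi> * L - \<mu>)\<^sup>2 / (4 * \<mu> * M)"
  have "q < \<phi>"
    using \<phi> \<mu> M by (simp add: q_def pos_divide_less_eq mult_ac)
  moreover have "0 \<le> q"
    using \<mu> M by (simp add: q_def)
  ultimately have "0 < (q + \<phi>) / 2" and "(q + \<phi>) / 2 < \<phi>" and "q < (q + \<phi>) / 2"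
    by simp_all
  have "(\<phi> * L - \<mu>)\<^sup>2 = 4 * q * \<mu> * M"
    using \<mu> M by (simp add: q_def)
  also have "\<dots> < 4 * ((q + \<phi>) / 2) * \<mu> * M"
    using \<open>q < (q + \<phi>) / 2\<close> \<mu> M by simp
  finally show ?thesis
    using \<open>0 < (q + \<phi>) / 2\<close> \<open>(q + \<phi>) / 2 < \<phi>\<close> by blast
qed

text \<open>\<open>\<phi>\<^sub>1\<close> is chosen first; \<open>\<phi>\<^sub>2\<close> is then chosen against the margin \<open>\<sigma>\<close> left over by \<open>\<phi>\<^sub>1\<close>.\<close>

lemma multipliers_exist:
  fixes \<mu> m Lfh Lh K :: real
  assumes \<mu>: "0 < \<mu>" and m: "0 < m" and Lfh: "- m < Lfh" and Lh: "0 \<le> Lh"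
  shows "\<exists>\<phi>1\<ge>0. \<exists>\<phi>2\<ge>0. \<exists>\<kappa>>0. \<forall>b s1 s2.
    - \<mu> * m * b\<^sup>2 + \<bar>\<phi>1 * Lfh - \<mu>\<bar> * b * s1 - \<phi>1 * s1\<^sup>2 + \<bar>\<phi>2 * Lh - \<mu>\<bar> * K * b * s2 - \<phi>2 * s2\<^sup>2
      \<le> - \<kappa> * (b\<^sup>2 + s1\<^sup>2 + s2\<^sup>2)"
proof -
  obtain \<phi>1 \<phi>1' where \<phi>1: "0 < \<phi>1'" "\<phi>1' < \<phi>1" "(\<phi>1 * Lfh - \<mu>)\<^sup>2 < 4 * \<phi>1' * \<mu> * m"
    using sector_multiplier_exists[OF \<mu> m Lfh] by blast
  define \<sigma> where "\<sigma> = \<mu> * m - (\<phi>1 * Lfh - \<mu>)\<^sup>2 / (4 * \<phi>1')"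
  have "(\<phi>1 * Lfh - \<mu>)\<^sup>2 / (4 * \<phi>1') < \<mu> * m"
    using \<phi>1 by (simp add: pos_divide_less_eq mult_ac)
  then have \<sigma>: "0 < \<sigma>"
    by (simp add: \<sigma>_def)
  define K' where "K' = \<bar>K\<bar> + 1"
  have K': "0 < K'" "K\<^sup>2 \<le> K'\<^sup>2"
    unfolding K'_def using power_mono[of "\<bar>K\<bar>" "\<bar>K\<bar> + 1" 2] by auto
  have "0 < \<sigma> / (4 * \<mu> * K'\<^sup>2)"
    using \<sigma> \<mu> K' by simp
  moreover from this have "- (\<sigma> / (4 * \<mu> * K'\<^sup>2)) < Lh"
    using Lh by linarith
  ultimately obtain \<phi>2 \<phi>2' where \<phi>2: "0 < \<phi>2'" "\<phi>2' < \<phi>2"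
    "(\<phi>2 * Lh - \<mu>)\<^sup>2 < 4 * \<phi>2' * \<mu> * (\<sigma> / (4 * \<mu> * K'\<^sup>2))"
    using sector_multiplier_exists[OF \<mu>] by blast
  have c2: "(\<phi>2 * Lh - \<mu>)\<^sup>2 * K\<^sup>2 / (4 * \<phi>2') \<le> \<sigma> / 4"
  proof -
    have "(\<phi>2 * Lh - \<mu>)\<^sup>2 * K\<^sup>2 \<le> (\<phi>2 * Lh - \<mu>)\<^sup>2 * K'\<^sup>2"
      using K' by (intro mult_left_mono) auto
    also have "\<dots> \<le> \<phi>2' * \<sigma>"
      using \<phi>2(3) \<mu> K' by (simp add: field_simps)
    finally show ?thesis
      using \<phi>2 by (simp add: pos_divide_le_eq mult.commute)
  qed
  define \<kappa> where "\<kappa> = min (3 * \<sigma> / 4) (min (\<phi>1 - \<phi>1') (\<phi>2 - \<phi>2'))"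
  have "- \<mu> * m * b\<^sup>2 + \<bar>\<phi>1 * Lfh - \<mu>\<bar> * b * s1 - \<phi>1 * s1\<^sup>2 + \<bar>\<phi>2 * Lh - \<mu>\<bar> * K * b * s2 - \<phi>2 * s2\<^sup>2
      \<le> - \<kappa> * (b\<^sup>2 + s1\<^sup>2 + s2\<^sup>2)" for b s1 s2
  proof -
    have "\<bar>\<phi>1 * Lfh - \<mu>\<bar> * b * s1 \<le> (\<mu> * m - \<sigma>) * b\<^sup>2 + \<phi>1' * s1\<^sup>2"
      using mult_le_sq_div_add_sq[OF \<phi>1(1), of "\<bar>\<phi>1 * Lfh - \<mu>\<bar> * b" s1]
      by (simp add: \<sigma>_def algebra_simps)
    moreover have "\<bar>\<phi>2 * Lh - \<mu>\<bar> * K * b * s2 \<le> \<sigma> / 4 * b\<^sup>2 + \<phi>2' * s2\<^sup>2"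
      using mult_le_sq_div_add_sq[OF \<phi>2(1), of "\<bar>\<phi>2 * Lh - \<mu>\<bar> * K * b" s2]
        mult_right_mono[OF c2, of "b\<^sup>2"]
      by (simp add: algebra_simps)
    moreover have "\<kappa> \<le> 3 * \<sigma> / 4" "\<kappa> \<le> \<phi>1 - \<phi>1'" "\<kappa> \<le> \<phi>2 - \<phi>2'"
      unfolding \<kappa>_def by (auto simp: min_def)
    then have "\<kappa> * b\<^sup>2 \<le> 3 * \<sigma> / 4 * b\<^sup>2" "\<kappa> * s1\<^sup>2 \<le> (\<phi>1 - \<phi>1') * s1\<^sup>2"
      "\<kappa> * s2\<^sup>2 \<le> (\<phi>2 - \<phi>2') * s2\<^sup>2"
      using zero_le_power2 by (blast intro: mult_right_mono)+
    ultimately show ?thesis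
      by (simp add: algebra_simps)
  qed
  moreover have "0 < \<kappa>"
    using \<sigma> \<phi>1 \<phi>2 unfolding \<kappa>_def by auto
  moreover have "0 \<le> \<phi>1" "0 \<le> \<phi>2"
    using \<phi>1 \<phi>2 by auto
  ultimately show ?thesis
    by blast
qed

lemma coupling_absorbed:
  fixes D \<kappa>0 l b s1 s2 se :: real
  assumes D: "0 < D" and \<kappa>0: "0 < \<kappa>0"
  shows "D * (2 * l * b + l * s1 + l * s2 + l * se + b * se)
    \<le> \<kappa>0 / 2 * l\<^sup>2 + (5 * D\<^sup>2 / \<kappa>0 + D) * (b\<^sup>2 + s1\<^sup>2 + s2\<^sup>2 + se\<^sup>2)"
proof -
  define q where "q = 5 * D\<^sup>2 / \<kappa>0 / 2"
  have l: "D * (l * y) \<le> \<kappa>0 / 10 * l\<^sup>2 + q * y\<^sup>2" for y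
    using mult_le_sq_div_add_sq[of "\<kappa>0 / 10" "D * y" l] \<kappa>0
    by (simp add: q_def field_simps)
  have "D * (b * se) \<le> D / 2 * b\<^sup>2 + D / 2 * se\<^sup>2"
    using mult_left_mono[OF sum_squares_bound[of b se], of D] D by (simp add: algebra_simps)
  then have "D * (2 * l * b + l * s1 + l * s2 + l * se + b * se)
      \<le> \<kappa>0 / 2 * l\<^sup>2 + (2 * q + D / 2) * b\<^sup>2 + q * s1\<^sup>2 + q * s2\<^sup>2 + (q + D / 2) * se\<^sup>2"
    using l[of b] l[of s1] l[of s2] l[of se] by (simp add: algebra_simps mult.commute[of l b])
  also have "\<dots> \<le> \<kappa>0 / 2 * l\<^sup>2 + (5 * D\<^sup>2 / \<kappa>0 + D) * (b\<^sup>2 + s1\<^sup>2 + s2\<^sup>2 + se\<^sup>2)"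
  proof -
    have "0 \<le> q"
      using \<kappa>0 by (simp add: q_def)
    then have "2 * q + D / 2 \<le> 5 * D\<^sup>2 / \<kappa>0 + D" "q \<le> 5 * D\<^sup>2 / \<kappa>0 + D"
      "q + D / 2 \<le> 5 * D\<^sup>2 / \<kappa>0 + D"
      using D by (auto simp: q_def)
    then have "(2 * q + D / 2) * b\<^sup>2 \<le> (5 * D\<^sup>2 / \<kappa>0 + D) * b\<^sup>2"
      "q * s1\<^sup>2 \<le> (5 * D\<^sup>2 / \<kappa>0 + D) * s1\<^sup>2" "q * s2\<^sup>2 \<le> (5 * D\<^sup>2 / \<kappa>0 + D) * s2\<^sup>2"
      "(q + D / 2) * se\<^sup>2 \<le> (5 * D\<^sup>2 / \<kappa>0 + D) * se\<^sup>2"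
      by (auto intro!: mult_right_mono)
    then show ?thesis
      unfolding distrib_left by linarith
  qed
  finally show ?thesis .
qed

text \<open>Singular perturbation in scalar form: the fast variable \<open>a\<close> is damped at rate
  \<open>\<kappa>\<^sub>X/\<epsilon>\<close>, which beats its coupling to the slow variables for small \<open>\<epsilon>\<close>, and a small
  exponential rate \<open>\<rho>\<close> is then absorbed by the remaining margin.\<close>

lemma singular_perturbation_margin:
  fixes \<kappa>X \<kappa> Cv Cx :: real
  assumes \<kappa>X: "0 < \<kappa>X" and \<kappa>: "0 < \<kappa>" and Cv: "0 \<le> Cv"
  shows "\<exists>\<epsilon>>0. \<exists>\<rho>>0. \<forall>a S W. S\<^sup>2 \<le> 4 * W \<longrightarrow>
    \<rho> * Cv * (a\<^sup>2 + W) - \<kappa>X / \<epsilon> * a\<^sup>2 + Cx * a * S - \<kappa> * W \<le> 0"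
proof (intro exI conjI allI impI)
  define d where "d = 2 * Cx\<^sup>2 / \<kappa> + 1"
  have d: "1 \<le> d"
    using \<kappa> by (simp add: d_def)
  show "0 < \<kappa>X / d"
    using \<kappa>X d by simp
  define \<rho> where "\<rho> = min 1 (\<kappa> / 2) / (Cv + 1)"
  show "0 < \<rho>"
    using \<kappa> Cv by (simp add: \<rho>_def)
  have "\<rho> * Cv = min 1 (\<kappa> / 2) * (Cv / (Cv + 1))"
    by (simp add: \<rho>_def)
  also have "\<dots> \<le> min 1 (\<kappa> / 2)"
    using Cv \<kappa> by (intro mult_left_le) auto
  finally have \<rho>Cv: "\<rho> * Cv \<le> 1" "\<rho> * Cv \<le> \<kappa> / 2"
    by auto
  fix a S W :: real
  assume SW: "S\<^sup>2 \<le> 4 * W"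
  have "Cx * a * S \<le> (Cx * a)\<^sup>2 / (4 * (\<kappa> / 8)) + \<kappa> / 8 * S\<^sup>2"
    using mult_le_sq_div_add_sq[of "\<kappa> / 8" "Cx * a" S] \<kappa> by simp
  also have "\<dots> \<le> (d - 1) * a\<^sup>2 + \<kappa> / 2 * W"
    using SW \<kappa> by (simp add: d_def field_simps)
  finally have "Cx * a * S \<le> (d - 1) * a\<^sup>2 + \<kappa> / 2 * W" .
  moreover have "\<kappa>X / (\<kappa>X / d) = d"
    using \<kappa>X d by simp
  moreover have "0 \<le> W"
    using SW zero_le_power2[of S] by linarith
  ultimately show "\<rho> * Cv * (a\<^sup>2 + W) - \<kappa>X / (\<kappa>X / d) * a\<^sup>2 + Cx * a * S - \<kappa> * W \<le> 0"
    using \<rho>Cv mult_right_mono[OF \<rho>Cv(1), of "a\<^sup>2"] mult_right_mono[OF \<rho>Cv(2), of W]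
    by (simp add: algebra_simps)
qed

section \<open>The Lyapunov certificate\<close>

text \<open>The \<open>x\<close>-block measures the deviation \<open>x + T u\<close> of the plant from its steady state
  \<open>- A\<^sup>-\<^sup>1 B u\<close>, where \<open>T = A\<^sup>-\<^sup>1 B\<close>.\<close>

definition lmi_certificate ::
  "real^'n^'n \<Rightarrow> real^'p^'n \<Rightarrow> real^'p^'r \<Rightarrow> real \<Rightarrow> real \<Rightarrow> real^('n + 'p + 'r)^('n + 'p + 'r)" where
  "lmi_certificate X T Pi2 \<mu> \<delta> = block3
     X (X ** T) 0
     (transpose T ** X) (transpose T ** X ** T + \<mu> *\<^sub>R mat 1) (\<delta> *\<^sub>R transpose Pi2)
     0 (\<delta> *\<^sub>R Pi2) (\<mu> *\<^sub>R mat 1)"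

lemma lmi_certificate_form:
  fixes X :: "real^'n::finite^'n" and T :: "real^'p::finite^'n" and Pi2 :: "real^'p^'r::finite"
  assumes X: "transpose X = X"
  shows "join_vec x (join_vec u l) \<bullet> (lmi_certificate X T Pi2 \<mu> \<delta> *v join_vec x (join_vec u l))
    = (x + T *v u) \<bullet> (X *v (x + T *v u)) + \<mu> * (norm u)\<^sup>2 + 2 * \<delta> * ((Pi2 *v u) \<bullet> l) + \<mu> * (norm l)\<^sup>2"
  using inner_symmetric_matrix[OF X, of x "T *v u"]
  by (simp add: lmi_certificate_def block3_mult_join_vec inner_vector_matrix
      scaleR_matrix_vector_assoc[symmetric] matrix_vector_mul_assoc[symmetric] dot_square_norm
      algebra_simps inner_commute)

lemma lmi_certificate_bounds:
  fixes X :: "real^'n::finite^'n" and T :: "real^'p::finite^'n" and Pi2 :: "real^'p^'r::finite"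
    and x :: "real^'n" and u :: "real^'p" and l :: "real^'r"
  assumes X: "transpose X = X" "\<And>x. (norm x)\<^sup>2 \<le> x \<bullet> (X *v x)"
    and \<delta>: "0 \<le> \<delta>" "\<delta> * onorm ((*v) Pi2) \<le> \<mu> / 2"
  defines "V \<equiv> join_vec x (join_vec u l) \<bullet> (lmi_certificate X T Pi2 \<mu> \<delta> *v join_vec x (join_vec u l))"
  shows "(norm (x + T *v u))\<^sup>2 + \<mu> / 2 * ((norm u)\<^sup>2 + (norm l)\<^sup>2) \<le> V"
    and "V \<le> (onorm ((*v) X) + 3 / 2 * \<mu>) * ((norm (x + T *v u))\<^sup>2 + (norm u)\<^sup>2 + (norm l)\<^sup>2)"
proof -
  have "0 \<le> \<delta> * onorm ((*v) Pi2)"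
    using \<delta>(1) by (simp add: onorm_pos_le)
  then have \<mu>: "0 \<le> \<mu>"
    using \<delta>(2) by linarith
  have "2 * \<delta> * \<bar>(Pi2 *v u) \<bullet> l\<bar> \<le> \<delta> * onorm ((*v) Pi2) * (2 * norm u * norm l)"
    using mult_left_mono[OF abs_inner_matrix_le_onorm[of Pi2 u l], of "2 * \<delta>"] \<delta>(1) by (simp add: algebra_simps)
  also have "\<dots> \<le> \<mu> / 2 * ((norm u)\<^sup>2 + (norm l)\<^sup>2)"
    using \<delta> \<mu> sum_squares_bound[of "norm u" "norm l"] onorm_pos_le[OF matrix_vector_mul_bounded_linear]
    by (intro mult_mono) auto
  finally have "\<bar>2 * \<delta> * ((Pi2 *v u) \<bullet> l)\<bar> \<le> \<mu> / 2 * ((norm u)\<^sup>2 + (norm l)\<^sup>2)"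
    using \<delta>(1) by (simp add: abs_mult)
  then have cross: "2 * \<delta> * ((Pi2 *v u) \<bullet> l) \<le> \<mu> / 2 * ((norm u)\<^sup>2 + (norm l)\<^sup>2)"
    "- (2 * \<delta> * ((Pi2 *v u) \<bullet> l)) \<le> \<mu> / 2 * ((norm u)\<^sup>2 + (norm l)\<^sup>2)"
    unfolding abs_le_iff by auto
  have "(x + T *v u) \<bullet> (X *v (x + T *v u)) \<le> onorm ((*v) X) * (norm (x + T *v u))\<^sup>2"
    using inner_matrix_le_onorm[of X "x + T *v u" "x + T *v u"]
    by (simp add: inner_commute power2_eq_square mult.assoc)
  moreover have "0 \<le> onorm ((*v) X) * ((norm u)\<^sup>2 + (norm l)\<^sup>2)" "0 \<le> \<mu> * (norm (x + T *v u))\<^sup>2"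
    using \<mu> by (simp_all add: onorm_pos_le)
  ultimately show "V \<le> (onorm ((*v) X) + 3 / 2 * \<mu>) * ((norm (x + T *v u))\<^sup>2 + (norm u)\<^sup>2 + (norm l)\<^sup>2)"
    using cross(1) unfolding V_def lmi_certificate_form[OF X(1)] by (simp add: algebra_simps)
  show "(norm (x + T *v u))\<^sup>2 + \<mu> / 2 * ((norm u)\<^sup>2 + (norm l)\<^sup>2) \<le> V"
    using cross(2) X(2)[of "x + T *v u"] unfolding V_def lmi_certificate_form[OF X(1)]
    by (simp add: algebra_simps)
qed

lemma pd_lmi_certificate:
  fixes X :: "real^'n::finite^'n" and T :: "real^'p::finite^'n" and Pi2 :: "real^'p^'r::finite"
  assumes X: "transpose X = X" "\<And>x. (norm x)\<^sup>2 \<le> x \<bullet> (X *v x)"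
    and \<mu>: "0 < \<mu>" and \<delta>: "0 \<le> \<delta>" "\<delta> * onorm ((*v) Pi2) \<le> \<mu> / 2"
  shows "pd (lmi_certificate X T Pi2 \<mu> \<delta>)"
  unfolding pd_def
proof (intro conjI allI impI)
  show "transpose (lmi_certificate X T Pi2 \<mu> \<delta>) = lmi_certificate X T Pi2 \<mu> \<delta>"
    unfolding lmi_certificate_def transpose_block3
    by (simp add: X(1) matrix_transpose_mul matrix_transpose_add transpose_scalar matrix_mul_assoc)
  fix \<xi> :: "real^('n + 'p + 'r)"
  assume "\<xi> \<noteq> 0"
  obtain x u l where \<xi>: "\<xi> = join_vec x (join_vec u l)"
    by (metis join_vec_cases)
  have "0 < (norm (x + T *v u))\<^sup>2 + \<mu> / 2 * ((norm u)\<^sup>2 + (norm l)\<^sup>2)"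
  proof (cases "x + T *v u = 0")
    case True
    then have "u \<noteq> 0 \<or> l \<noteq> 0"
      using \<open>\<xi> \<noteq> 0\<close> unfolding \<xi> by auto
    then have "0 < (norm u)\<^sup>2 + (norm l)\<^sup>2"
      by (auto intro: add_pos_nonneg add_nonneg_pos)
    with \<mu> show ?thesis
      by (intro add_nonneg_pos) auto
  next
    case False
    then show ?thesis
      using \<mu> by (intro add_pos_nonneg) auto
  qed
  then show "0 < \<xi> \<bullet> (lmi_certificate X T Pi2 \<mu> \<delta> *v \<xi>)"
    using lmi_certificate_bounds(1)[OF X \<delta>, where x = x and T = T and u = u and l = l] unfolding \<xi> by linarith
qed

lemma symmetric_Xi:
  "transpose (Xi Lfh Lh \<phi>1 \<phi>2 :: real^(('p::finite + 'r1::finite + 'r2::finite) + ('p + 'r1 + 'r2))^_)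
    = Xi Lfh Lh \<phi>1 \<phi>2"
  unfolding Xi_def transpose_block2 transpose_block3 by (simp add: transpose_scalar matrix_transpose_uminus)

text \<open>The supply rate of the quasi-steady-state system, obtained by freezing the plant at
  \<open>x = - T u\<close> (so that \<open>y\<^sub>1 = \<Pi2>\<^sub>1 u\<close> and \<open>y\<^sub>2 + \<mu> \<lambda> = \<Pi2>\<^sub>2 u + \<mu> \<lambda>\<close>), measured with the
  \<open>(u, \<lambda>)\<close>-block of the certificate; it is half the corresponding LMI form.\<close>

definition reduced_supply ::
  "real^'p^'r1 \<Rightarrow> real^'p^'r2 \<Rightarrow> real^'r2^'r2 \<Rightarrow> real \<Rightarrow> real \<Rightarrow> real \<Rightarrow> real \<Rightarrow> real \<Rightarrow> real \<Rightarrow> real \<Rightarrow> real \<Rightarrow>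
   real^'p \<Rightarrow> real^'r2 \<Rightarrow> real^'p \<Rightarrow> real^'r1 \<Rightarrow> real^'r2 \<Rightarrow> real" where
  "reduced_supply Pi1 Pi2 Q \<mu> m \<gamma> Lfh Lh \<phi>1 \<phi>2 \<delta> u l z1 z2 z3 =
     (\<mu> *\<^sub>R u + \<delta> *\<^sub>R (transpose Pi2 *v l))
       \<bullet> (- (m *\<^sub>R u) - z1 - transpose Pi1 *v z2 - (1 / \<mu>) *\<^sub>R (transpose Pi2 *v z3))
     + (\<delta> *\<^sub>R (Pi2 *v u) + \<mu> *\<^sub>R l) \<bullet> (z3 - \<mu> *\<^sub>R l - \<gamma> *\<^sub>R (Q *v l))
     + \<phi>1 * Lfh * (u \<bullet> z1) + \<phi>2 * Lh * ((Pi1 *v u) \<bullet> z2) + (Pi2 *v u + \<mu> *\<^sub>R l) \<bullet> z3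
     - \<phi>1 * (z1 \<bullet> z1) - \<phi>2 * (z2 \<bullet> z2) - z3 \<bullet> z3"

text \<open>Because \<open>A T = B\<close>, the plant enters only through \<open>x + T u\<close>, and the LMI form splits
  into the decay of the certificate, the plant dissipation, a coupling that is bilinear in
  \<open>x + T u\<close> and the algorithm variables, and the reduced supply rate.\<close>

lemma lmi_form_decomposition:
  fixes A :: "real^'n::finite^'n" and B T :: "real^'p::finite^'n" and C1 :: "real^'n^'r1::finite"
    and C2 :: "real^'n^'r2::finite" and Pi1 :: "real^'p^'r1" and Pi2 :: "real^'p^'r2" and X :: "real^'n^'n"
    and x :: "real^'n" and u z1 :: "real^'p" and l z3 :: "real^'r2" and z2 :: "real^'r1" and \<mu> \<delta> :: real
  assumes AT: "A ** T = B" and Pi1: "Pi1 = - (C1 ** T)" and Pi2: "Pi2 = - (C2 ** T)"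
    and X: "transpose X = X" and \<mu>: "\<mu> \<noteq> 0"
  defines "\<xi> \<equiv> join_vec x (join_vec u l)" and "\<zeta> \<equiv> join_vec z1 (join_vec z2 z3)"
    and "P \<equiv> lmi_certificate X T Pi2 \<mu> \<delta>" and "xt \<equiv> x + T *v u"
  shows "2 * ((P *v \<xi>) \<bullet> (AA_rho A B m \<mu> Q \<gamma> \<epsilon> \<rho> *v \<xi> + BB Pi1 Pi2 \<mu> *v \<zeta>))
      + join_vec (CC C1 C2 \<mu> *v \<xi>) \<zeta> \<bullet> (Xi Lfh Lh \<phi>1 \<phi>2 *v join_vec (CC C1 C2 \<mu> *v \<xi>) \<zeta>)
    = 2 * (\<rho> * (\<xi> \<bullet> (P *v \<xi>)) + (X *v xt) \<bullet> (A *v xt) / \<epsilon>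
      + ((transpose T *v (X *v xt)) \<bullet> (- (m *\<^sub>R u) - z1 - transpose Pi1 *v z2 - (1 / \<mu>) *\<^sub>R (transpose Pi2 *v z3))
        + \<phi>2 * Lh * ((C1 *v xt) \<bullet> z2) + (C2 *v xt) \<bullet> z3)
      + reduced_supply Pi1 Pi2 Q \<mu> m \<gamma> Lfh Lh \<phi>1 \<phi>2 \<delta> u l z1 z2 z3)"
proof -
  have "2 * ((P *v \<xi>) \<bullet> (AA_rho A B m \<mu> Q \<gamma> \<epsilon> \<rho> *v \<xi> + BB Pi1 Pi2 \<mu> *v \<zeta>))
      + join_vec (CC C1 C2 \<mu> *v \<xi>) \<zeta> \<bullet> (Xi Lfh Lh \<phi>1 \<phi>2 *v join_vec (CC C1 C2 \<mu> *v \<xi>) \<zeta>)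
    = 2 * ((X *v x + X *v (T *v u)) \<bullet> ((1/\<epsilon>) *\<^sub>R (A *v x) + (1/\<epsilon>) *\<^sub>R (B *v u) + \<rho> *\<^sub>R x)
      + (transpose T *v (X *v x) + transpose T *v (X *v (T *v u)) + \<mu> *\<^sub>R u + \<delta> *\<^sub>R (transpose Pi2 *v l))
          \<bullet> (- (m *\<^sub>R u) + \<rho> *\<^sub>R u - z1 - transpose Pi1 *v z2 - (1/\<mu>) *\<^sub>R (transpose Pi2 *v z3))
      + (\<delta> *\<^sub>R (Pi2 *v u) + \<mu> *\<^sub>R l) \<bullet> (- (\<mu> *\<^sub>R l) - \<gamma> *\<^sub>R (Q *v l) + \<rho> *\<^sub>R l + z3)
      + \<phi>1 * Lfh * (u \<bullet> z1) + \<phi>2 * Lh * ((C1 *v x) \<bullet> z2) + (C2 *v x + \<mu> *\<^sub>R l) \<bullet> z3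
      - \<phi>1 * (z1 \<bullet> z1) - \<phi>2 * (z2 \<bullet> z2) - z3 \<bullet> z3)"
    unfolding \<xi>_def \<zeta>_def P_def
    by (simp add: lmi_certificate_def AA_rho_def AA_def BB_def CC_def Xi_def block3_mult_join_vec
        block2_mult_join_vec scaleR_matrix_vector_assoc[symmetric] matrix_vector_mult_uminus
        matrix_vector_mul_assoc[symmetric] algebra_simps inner_commute)
  also have "\<dots> = 2 * (\<rho> * (\<xi> \<bullet> (P *v \<xi>)) + (X *v xt) \<bullet> (A *v xt) / \<epsilon>
      + ((transpose T *v (X *v xt)) \<bullet> (- (m *\<^sub>R u) - z1 - transpose Pi1 *v z2 - (1 / \<mu>) *\<^sub>R (transpose Pi2 *v z3))
        + \<phi>2 * Lh * ((C1 *v xt) \<bullet> z2) + (C2 *v xt) \<bullet> z3)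
      + reduced_supply Pi1 Pi2 Q \<mu> m \<gamma> Lfh Lh \<phi>1 \<phi>2 \<delta> u l z1 z2 z3)"
  proof -
    have "A *v (T *v u) = B *v u" "C1 *v (T *v u) = - (Pi1 *v u)" "C2 *v (T *v u) = - (Pi2 *v u)"
      by (simp_all add: AT Pi1 Pi2 matrix_vector_mul_assoc matrix_vector_mult_uminus)
    then show ?thesis
      using \<mu> unfolding \<xi>_def P_def xt_def lmi_certificate_form[OF X] reduced_supply_def
      by (simp add: matrix_vector_mult_uminus matrix_vector_mult_uminus_right inner_vector_matrix
          dot_square_norm algebra_simps inner_commute add_divide_distrib)
  qed
  finally show ?thesis .
qed

section \<open>The reduced system\<close>

text \<open>In the variable \<open>e = z\<^sub>3 - \<mu> \<lambda>\<close> the cross terms between \<open>\<lambda>\<close> and \<open>z\<^sub>3\<close> cancel.\<close>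

lemma reduced_supply_shifted:
  assumes \<mu>: "\<mu> \<noteq> 0"
  shows "reduced_supply Pi1 Pi2 Q \<mu> m \<gamma> Lfh Lh \<phi>1 \<phi>2 \<delta> u l z1 z2 (e + \<mu> *\<^sub>R l)
    = - \<mu> * m * (norm u)\<^sup>2 + (\<phi>1 * Lfh - \<mu>) * (u \<bullet> z1) - \<phi>1 * (norm z1)\<^sup>2
      + (\<phi>2 * Lh - \<mu>) * ((Pi1 *v u) \<bullet> z2) - \<phi>2 * (norm z2)\<^sup>2 - (norm e)\<^sup>2
      - \<mu> * \<gamma> * (l \<bullet> (Q *v l)) - \<delta> * (norm (transpose Pi2 *v l))\<^sup>2
      + \<delta> * (- m * ((transpose Pi2 *v l) \<bullet> u) - (transpose Pi2 *v l) \<bullet> z1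
        - (transpose Pi2 *v l) \<bullet> (transpose Pi1 *v z2) - (transpose Pi2 *v l) \<bullet> (transpose Pi2 *v e) / \<mu>
        + (Pi2 *v u) \<bullet> e - \<gamma> * ((Pi2 *v u) \<bullet> (Q *v l)))"
  using \<mu>
  by (simp add: reduced_supply_def inner_vector_matrix power2_norm_eq_inner
      algebra_simps inner_commute add_divide_distrib diff_divide_distrib)

lemma reduced_coupling_le:
  fixes Pi1 :: "real^'p::finite^'r1::finite" and Pi2 :: "real^'p^'r2::finite" and Q :: "real^'r2^'r2"
  assumes K: "onorm ((*v) (transpose Pi1)) \<le> K" "onorm ((*v) Pi2) \<le> K"
      "onorm ((*v) (transpose Pi2)) \<le> K" "onorm ((*v) Q) \<le> K"
    and \<mu>: "0 < \<mu>" and m: "0 \<le> m" and \<gamma>: "0 \<le> \<gamma>"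
  shows "- m * ((transpose Pi2 *v l) \<bullet> u) - (transpose Pi2 *v l) \<bullet> z1
      - (transpose Pi2 *v l) \<bullet> (transpose Pi1 *v z2) - (transpose Pi2 *v l) \<bullet> (transpose Pi2 *v e) / \<mu>
      + (Pi2 *v u) \<bullet> e - \<gamma> * ((Pi2 *v u) \<bullet> (Q *v l))
    \<le> (m * K + K\<^sup>2 + K\<^sup>2 / \<mu> + \<gamma> * K\<^sup>2 + K)
      * (2 * norm l * norm u + norm l * norm z1 + norm l * norm z2 + norm l * norm e + norm u * norm e)"
proof -
  note bound = norm_matrix_vector_le[OF K(1)] norm_matrix_vector_le[OF K(2)]
    norm_matrix_vector_le[OF K(3)] norm_matrix_vector_le[OF K(4)]
  have "0 \<le> K"
    using K(2) onorm_pos_le[OF matrix_vector_mul_bounded_linear] order_trans by blast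
  define D where "D = m * K + K\<^sup>2 + K\<^sup>2 / \<mu> + \<gamma> * K\<^sup>2 + K"
  have D: "m * K \<le> D" "K\<^sup>2 \<le> D" "K\<^sup>2 / \<mu> \<le> D" "\<gamma> * K\<^sup>2 \<le> D" "K \<le> D"
    using \<open>0 \<le> K\<close> m \<mu> \<gamma> unfolding D_def by simp_all
  have "\<bar>(transpose Pi2 *v l) \<bullet> u\<bar> \<le> K * norm l * norm u"
    "\<bar>(transpose Pi2 *v l) \<bullet> z1\<bar> \<le> K * norm l * norm z1"
    "\<bar>(transpose Pi2 *v l) \<bullet> (transpose Pi1 *v z2)\<bar> \<le> K\<^sup>2 * norm l * norm z2"
    "\<bar>(transpose Pi2 *v l) \<bullet> (transpose Pi2 *v e)\<bar> \<le> K\<^sup>2 * norm l * norm e"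
    "\<bar>(Pi2 *v u) \<bullet> e\<bar> \<le> K * norm u * norm e"
    "\<bar>(Pi2 *v u) \<bullet> (Q *v l)\<bar> \<le> K\<^sup>2 * norm l * norm u"
    using abs_inner_le_mult[OF bound(3) order_refl, of l] abs_inner_le_mult[OF bound(2) order_refl, of u]
      abs_inner_le_mult[OF bound(3) bound(1), of l z2] abs_inner_le_mult[OF bound(3) bound(3), of l e]
      abs_inner_le_mult[OF bound(2) bound(4), of u l]
    by (simp_all add: power2_eq_square mult_ac)
  then have "- m * ((transpose Pi2 *v l) \<bullet> u) \<le> m * K * (norm l * norm u)"
    "- ((transpose Pi2 *v l) \<bullet> (transpose Pi2 *v e) / \<mu>) \<le> K\<^sup>2 / \<mu> * (norm l * norm e)"
    "- (\<gamma> * ((Pi2 *v u) \<bullet> (Q *v l))) \<le> \<gamma> * K\<^sup>2 * (norm l * norm u)"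
    "- ((transpose Pi2 *v l) \<bullet> z1) \<le> K * (norm l * norm z1)"
    "- ((transpose Pi2 *v l) \<bullet> (transpose Pi1 *v z2)) \<le> K\<^sup>2 * (norm l * norm z2)"
    "(Pi2 *v u) \<bullet> e \<le> K * (norm u * norm e)"
    using neg_mult_le_of_abs_le[of _ _ m] neg_mult_le_of_abs_le[of _ _ "1 / \<mu>"]
      neg_mult_le_of_abs_le[of _ _ \<gamma>] m \<mu> \<gamma>
    by (force simp: mult_ac abs_le_iff)+
  then have "- m * ((transpose Pi2 *v l) \<bullet> u) - (transpose Pi2 *v l) \<bullet> z1
      - (transpose Pi2 *v l) \<bullet> (transpose Pi1 *v z2) - (transpose Pi2 *v l) \<bullet> (transpose Pi2 *v e) / \<mu>
      + (Pi2 *v u) \<bullet> e - \<gamma> * ((Pi2 *v u) \<bullet> (Q *v l))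
    \<le> m * K * (norm l * norm u) + K * (norm l * norm z1) + K\<^sup>2 * (norm l * norm z2)
      + K\<^sup>2 / \<mu> * (norm l * norm e) + K * (norm u * norm e) + \<gamma> * K\<^sup>2 * (norm l * norm u)"
    by linarith
  also have "\<dots> \<le> D * (2 * norm l * norm u + norm l * norm z1 + norm l * norm z2 + norm l * norm e + norm u * norm e)"
  proof -
    have "m * K * (norm l * norm u) \<le> D * (norm l * norm u)" "K * (norm l * norm z1) \<le> D * (norm l * norm z1)"
      "K\<^sup>2 * (norm l * norm z2) \<le> D * (norm l * norm z2)" "K\<^sup>2 / \<mu> * (norm l * norm e) \<le> D * (norm l * norm e)"
      "K * (norm u * norm e) \<le> D * (norm u * norm e)" "\<gamma> * K\<^sup>2 * (norm l * norm u) \<le> D * (norm l * norm u)"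
      by (rule mult_right_mono; use D in simp)+
    then show ?thesis
      unfolding distrib_left by linarith
  qed
  finally show ?thesis
    unfolding D_def .
qed

lemma reduced_supply_le:
  fixes Pi1 :: "real^'p::finite^'r1::finite" and Pi2 :: "real^'p^'r2::finite" and Q :: "real^'r2^'r2"
  assumes K: "onorm ((*v) Pi1) \<le> K" "onorm ((*v) (transpose Pi1)) \<le> K" "onorm ((*v) Pi2) \<le> K"
      "onorm ((*v) (transpose Pi2)) \<le> K" "onorm ((*v) Q) \<le> K"
    and \<mu>: "0 < \<mu>" and m: "0 \<le> m" and \<gamma>: "0 \<le> \<gamma>" and Q: "psd Q"
    and \<kappa>0: "\<And>l. \<kappa>0 * (norm l)\<^sup>2 \<le> (norm (transpose Pi2 *v l))\<^sup>2 + l \<bullet> (Q *v l)"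
    and \<delta>: "0 \<le> \<delta>" "\<delta> \<le> \<mu> * \<gamma>"
  shows "reduced_supply Pi1 Pi2 Q \<mu> m \<gamma> Lfh Lh \<phi>1 \<phi>2 \<delta> u l z1 z2 (e + \<mu> *\<^sub>R l)
    \<le> - \<mu> * m * (norm u)\<^sup>2 + \<bar>\<phi>1 * Lfh - \<mu>\<bar> * norm u * norm z1 - \<phi>1 * (norm z1)\<^sup>2
      + \<bar>\<phi>2 * Lh - \<mu>\<bar> * K * norm u * norm z2 - \<phi>2 * (norm z2)\<^sup>2 - (norm e)\<^sup>2 - \<delta> * \<kappa>0 * (norm l)\<^sup>2
      + \<delta> * ((m * K + K\<^sup>2 + K\<^sup>2 / \<mu> + \<gamma> * K\<^sup>2 + K)
        * (2 * norm l * norm u + norm l * norm z1 + norm l * norm z2 + norm l * norm e + norm u * norm e))"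
proof -
  have "(\<phi>1 * Lfh - \<mu>) * (u \<bullet> z1) \<le> \<bar>\<phi>1 * Lfh - \<mu>\<bar> * norm u * norm z1"
    using mult_le_abs_mult_of_abs_le[OF Cauchy_Schwarz_ineq2[of u z1]] by (simp only: mult.assoc)
  moreover have "(\<phi>2 * Lh - \<mu>) * ((Pi1 *v u) \<bullet> z2) \<le> \<bar>\<phi>2 * Lh - \<mu>\<bar> * K * norm u * norm z2"
    using mult_le_abs_mult_of_abs_le[OF abs_inner_le_mult[OF norm_matrix_vector_le[OF K(1)] order_refl]]
    by (simp only: mult.assoc)
  moreover have "- \<mu> * \<gamma> * (l \<bullet> (Q *v l)) - \<delta> * (norm (transpose Pi2 *v l))\<^sup>2 \<le> - \<delta> * \<kappa>0 * (norm l)\<^sup>2"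
  proof -
    have "0 \<le> l \<bullet> (Q *v l)"
      using Q unfolding psd_def by blast
    then have "\<delta> * (l \<bullet> (Q *v l)) \<le> \<mu> * \<gamma> * (l \<bullet> (Q *v l))"
      by (rule mult_right_mono[OF \<delta>(2)])
    moreover have "\<delta> * (\<kappa>0 * (norm l)\<^sup>2) \<le> \<delta> * ((norm (transpose Pi2 *v l))\<^sup>2 + l \<bullet> (Q *v l))"
      using \<kappa>0 \<delta>(1) by (rule mult_left_mono)
    ultimately show ?thesis
      by (simp add: algebra_simps)
  qed
  moreover have "\<delta> * (- m * ((transpose Pi2 *v l) \<bullet> u) - (transpose Pi2 *v l) \<bullet> z1
        - (transpose Pi2 *v l) \<bullet> (transpose Pi1 *v z2) - (transpose Pi2 *v l) \<bullet> (transpose Pi2 *v e) / \<mu>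
        + (Pi2 *v u) \<bullet> e - \<gamma> * ((Pi2 *v u) \<bullet> (Q *v l)))
      \<le> \<delta> * ((m * K + K\<^sup>2 + K\<^sup>2 / \<mu> + \<gamma> * K\<^sup>2 + K)
        * (2 * norm l * norm u + norm l * norm z1 + norm l * norm z2 + norm l * norm e + norm u * norm e))"
    using reduced_coupling_le[OF K(2-5) \<mu> m \<gamma>] \<delta>(1) by (rule mult_left_mono)
  ultimately show ?thesis
    unfolding reduced_supply_shifted[OF \<mu>[THEN less_imp_neq, symmetric]] by linarith
qed

lemma reduced_polynomial_le:
  fixes b l s1 s2 se :: real
  assumes diag: "- \<mu> * m * b\<^sup>2 + c1 * b * s1 - \<phi>1 * s1\<^sup>2 + c2 * b * s2 - \<phi>2 * s2\<^sup>2 \<le> - \<kappa>1 * (b\<^sup>2 + s1\<^sup>2 + s2\<^sup>2)"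
    and \<kappa>1: "0 < \<kappa>1" and D: "0 < D" and \<kappa>0: "0 < \<kappa>0"
    and \<delta>: "0 \<le> \<delta>" "\<delta> * (5 * D\<^sup>2 / \<kappa>0 + D) \<le> min \<kappa>1 1 / 2"
  shows "- \<mu> * m * b\<^sup>2 + c1 * b * s1 - \<phi>1 * s1\<^sup>2 + c2 * b * s2 - \<phi>2 * s2\<^sup>2 - se\<^sup>2 - \<delta> * \<kappa>0 * l\<^sup>2
      + \<delta> * (D * (2 * l * b + l * s1 + l * s2 + l * se + b * se))
    \<le> - min (min \<kappa>1 1 / 2) (\<delta> * \<kappa>0 / 2) * (b\<^sup>2 + l\<^sup>2 + s1\<^sup>2 + s2\<^sup>2 + se\<^sup>2)"
proof -
  define \<kappa> where "\<kappa> = min \<kappa>1 1"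
  define W where "W = b\<^sup>2 + s1\<^sup>2 + s2\<^sup>2 + se\<^sup>2"
  have W: "0 \<le> W"
    by (simp add: W_def)
  have "- \<kappa>1 * (b\<^sup>2 + s1\<^sup>2 + s2\<^sup>2) - se\<^sup>2 \<le> - \<kappa> * W"
    using mult_right_mono[of \<kappa> \<kappa>1 "b\<^sup>2 + s1\<^sup>2 + s2\<^sup>2"] mult_right_mono[of \<kappa> 1 "se\<^sup>2"]
    by (simp add: \<kappa>_def W_def algebra_simps)
  moreover have "\<delta> * (D * (2 * l * b + l * s1 + l * s2 + l * se + b * se))
      \<le> \<delta> * (\<kappa>0 / 2 * l\<^sup>2 + (5 * D\<^sup>2 / \<kappa>0 + D) * W)"
    unfolding W_def using coupling_absorbed[OF D \<kappa>0, of l b s1 s2 se] \<delta>(1) by (rule mult_left_mono)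
  ultimately have "- \<mu> * m * b\<^sup>2 + c1 * b * s1 - \<phi>1 * s1\<^sup>2 + c2 * b * s2 - \<phi>2 * s2\<^sup>2 - se\<^sup>2 - \<delta> * \<kappa>0 * l\<^sup>2
      + \<delta> * (D * (2 * l * b + l * s1 + l * s2 + l * se + b * se))
    \<le> - \<kappa> * W - \<delta> * \<kappa>0 * l\<^sup>2 + \<delta> * (\<kappa>0 / 2 * l\<^sup>2 + (5 * D\<^sup>2 / \<kappa>0 + D) * W)"
    using diag by linarith
  also have "\<dots> = - \<kappa> * W - \<delta> * \<kappa>0 / 2 * l\<^sup>2 + \<delta> * (5 * D\<^sup>2 / \<kappa>0 + D) * W"
    by (simp add: algebra_simps)
  also have "\<dots> \<le> - (\<kappa> / 2 * W) - \<delta> * \<kappa>0 / 2 * l\<^sup>2"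
    using mult_right_mono[OF \<delta>(2) W] unfolding \<kappa>_def by (simp add: algebra_simps)
  also have "\<dots> \<le> - (min (\<kappa> / 2) (\<delta> * \<kappa>0 / 2) * W) - min (\<kappa> / 2) (\<delta> * \<kappa>0 / 2) * l\<^sup>2"
    using mult_right_mono[OF min.cobounded1 W, of "\<kappa> / 2" "\<delta> * \<kappa>0 / 2"]
      mult_right_mono[OF min.cobounded2 zero_le_power2, of "\<kappa> / 2" "\<delta> * \<kappa>0 / 2" l]
    by linarith
  finally show ?thesis
    by (simp add: \<kappa>_def W_def algebra_simps)
qed

lemma reduced_supply_bound:
  fixes Pi1 :: "real^'p::finite^'r1::finite" and Pi2 :: "real^'p^'r2::finite" and Q :: "real^'r2^'r2"
  assumes K: "onorm ((*v) Pi1) \<le> K" "onorm ((*v) (transpose Pi1)) \<le> K" "onorm ((*v) Pi2) \<le> K"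
      "onorm ((*v) (transpose Pi2)) \<le> K" "onorm ((*v) Q) \<le> K"
    and \<mu>: "0 < \<mu>" and m: "0 \<le> m" and \<gamma>: "0 \<le> \<gamma>" and Q: "psd Q"
    and \<kappa>0: "0 < \<kappa>0" "\<And>l. \<kappa>0 * (norm l)\<^sup>2 \<le> (norm (transpose Pi2 *v l))\<^sup>2 + l \<bullet> (Q *v l)"
    and diag: "\<And>b s1 s2. - \<mu> * m * b\<^sup>2 + \<bar>\<phi>1 * Lfh - \<mu>\<bar> * b * s1 - \<phi>1 * s1\<^sup>2
      + \<bar>\<phi>2 * Lh - \<mu>\<bar> * K * b * s2 - \<phi>2 * s2\<^sup>2 \<le> - \<kappa>1 * (b\<^sup>2 + s1\<^sup>2 + s2\<^sup>2)"
    and \<kappa>1: "0 < \<kappa>1" and D: "D = m * K + K\<^sup>2 + K\<^sup>2 / \<mu> + \<gamma> * K\<^sup>2 + K" "0 < D"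
    and \<delta>: "0 \<le> \<delta>" "\<delta> \<le> \<mu> * \<gamma>" "\<delta> * (5 * D\<^sup>2 / \<kappa>0 + D) \<le> min \<kappa>1 1 / 2"
  defines "\<kappa> \<equiv> min (min \<kappa>1 1 / 2) (\<delta> * \<kappa>0 / 2)"
  shows "reduced_supply Pi1 Pi2 Q \<mu> m \<gamma> Lfh Lh \<phi>1 \<phi>2 \<delta> u l z1 z2 z3
    \<le> - (\<kappa> / (2 + 2 * \<mu>\<^sup>2)) * ((norm u)\<^sup>2 + (norm l)\<^sup>2 + (norm z1)\<^sup>2 + (norm z2)\<^sup>2 + (norm z3)\<^sup>2)"
proof -
  have \<kappa>: "0 \<le> \<kappa>"
    using \<kappa>1 \<delta>(1) \<kappa>0(1) by (simp add: \<kappa>_def)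
  define e where "e = z3 - \<mu> *\<^sub>R l"
  have "reduced_supply Pi1 Pi2 Q \<mu> m \<gamma> Lfh Lh \<phi>1 \<phi>2 \<delta> u l z1 z2 z3
      = reduced_supply Pi1 Pi2 Q \<mu> m \<gamma> Lfh Lh \<phi>1 \<phi>2 \<delta> u l z1 z2 (e + \<mu> *\<^sub>R l)"
    by (simp add: e_def)
  also have "\<dots> \<le> - \<mu> * m * (norm u)\<^sup>2 + \<bar>\<phi>1 * Lfh - \<mu>\<bar> * norm u * norm z1 - \<phi>1 * (norm z1)\<^sup>2
      + \<bar>\<phi>2 * Lh - \<mu>\<bar> * K * norm u * norm z2 - \<phi>2 * (norm z2)\<^sup>2 - (norm e)\<^sup>2 - \<delta> * \<kappa>0 * (norm l)\<^sup>2
      + \<delta> * (D * (2 * norm l * norm u + norm l * norm z1 + norm l * norm z2 + norm l * norm e + norm u * norm e))"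
    unfolding D(1) by (rule reduced_supply_le[OF K(1-5) \<mu> _ _ Q \<kappa>0(2)]) (use m \<gamma> \<delta> in auto)
  also have "\<dots> \<le> - \<kappa> * ((norm u)\<^sup>2 + (norm l)\<^sup>2 + (norm z1)\<^sup>2 + (norm z2)\<^sup>2 + (norm e)\<^sup>2)"
    unfolding \<kappa>_def by (rule reduced_polynomial_le[OF diag \<kappa>1 D(2) \<kappa>0(1)]) (use \<delta> in auto)
  also have "\<dots> \<le> - (\<kappa> / (2 + 2 * \<mu>\<^sup>2)) * ((norm u)\<^sup>2 + (norm l)\<^sup>2 + (norm z1)\<^sup>2 + (norm z2)\<^sup>2 + (norm z3)\<^sup>2)"
  proof -
    have "(norm u)\<^sup>2 + (norm l)\<^sup>2 + (norm z1)\<^sup>2 + (norm z2)\<^sup>2 + (norm z3)\<^sup>2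
        \<le> (2 + 2 * \<mu>\<^sup>2) * ((norm u)\<^sup>2 + (norm l)\<^sup>2 + (norm z1)\<^sup>2 + (norm z2)\<^sup>2 + (norm e)\<^sup>2)"
      using sum_norms_shift_le[of u l z1 z2 e \<mu>] by (simp add: e_def)
    then have "\<kappa> / (2 + 2 * \<mu>\<^sup>2) * ((norm u)\<^sup>2 + (norm l)\<^sup>2 + (norm z1)\<^sup>2 + (norm z2)\<^sup>2 + (norm z3)\<^sup>2)
        \<le> \<kappa> / (2 + 2 * \<mu>\<^sup>2) * ((2 + 2 * \<mu>\<^sup>2)
          * ((norm u)\<^sup>2 + (norm l)\<^sup>2 + (norm z1)\<^sup>2 + (norm z2)\<^sup>2 + (norm e)\<^sup>2))"
      by (rule mult_left_mono) (use \<kappa> in \<open>simp add: add_pos_nonneg\<close>)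
    moreover have "2 + 2 * \<mu>\<^sup>2 \<noteq> 0"
      using zero_le_power2[of \<mu>] by linarith
    ultimately show ?thesis
      by simp
  qed
  finally show ?thesis .
qed

lemma reduced_supply_negative:
  fixes Pi1 :: "real^'p::finite^'r1::finite" and Pi2 :: "real^'p^'r2::finite" and Q :: "real^'r2^'r2"
  assumes \<mu>: "0 < \<mu>" and m: "0 < m" and \<gamma>: "0 < \<gamma>" and Q: "psd Q"
    and kernel: "\<forall>l. transpose Pi2 *v l = 0 \<and> Q *v l = 0 \<longrightarrow> l = 0"
    and Lfh: "- m < Lfh" and Lh: "0 \<le> Lh"
  shows "\<exists>\<phi>1\<ge>0. \<exists>\<phi>2\<ge>0. \<exists>\<delta>0>0. \<forall>\<delta>. 0 < \<delta> \<and> \<delta> \<le> \<delta>0 \<longrightarrow> (\<exists>\<kappa>>0. \<forall>u l z1 z2 z3.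
    reduced_supply Pi1 Pi2 Q \<mu> m \<gamma> Lfh Lh \<phi>1 \<phi>2 \<delta> u l z1 z2 z3
      \<le> - \<kappa> * ((norm u)\<^sup>2 + (norm l)\<^sup>2 + (norm z1)\<^sup>2 + (norm z2)\<^sup>2 + (norm z3)\<^sup>2))"
proof -
  define K where "K = onorm ((*v) Pi1) + onorm ((*v) (transpose Pi1)) + onorm ((*v) Pi2)
    + onorm ((*v) (transpose Pi2)) + onorm ((*v) Q) + 1"
  have K: "onorm ((*v) Pi1) \<le> K" "onorm ((*v) (transpose Pi1)) \<le> K" "onorm ((*v) Pi2) \<le> K"
    "onorm ((*v) (transpose Pi2)) \<le> K" "onorm ((*v) Q) \<le> K" "0 < K"
    unfolding K_def using onorm_pos_le[OF matrix_vector_mul_bounded_linear[of Pi1]]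
      onorm_pos_le[OF matrix_vector_mul_bounded_linear[of "transpose Pi1"]]
      onorm_pos_le[OF matrix_vector_mul_bounded_linear[of Pi2]]
      onorm_pos_le[OF matrix_vector_mul_bounded_linear[of "transpose Pi2"]]
      onorm_pos_le[OF matrix_vector_mul_bounded_linear[of Q]]
    by linarith+
  obtain \<kappa>0 where \<kappa>0: "0 < \<kappa>0" "\<And>l. \<kappa>0 * (norm l)\<^sup>2 \<le> (norm (transpose Pi2 *v l))\<^sup>2 + l \<bullet> (Q *v l)"
    using psd_gram_coercive[OF Q kernel] by blast
  obtain \<phi>1 \<phi>2 \<kappa>1 where \<phi>: "0 \<le> \<phi>1" "0 \<le> \<phi>2" and \<kappa>1: "0 < \<kappa>1"
    and diag: "\<And>b s1 s2. - \<mu> * m * b\<^sup>2 + \<bar>\<phi>1 * Lfh - \<mu>\<bar> * b * s1 - \<phi>1 * s1\<^sup>2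
      + \<bar>\<phi>2 * Lh - \<mu>\<bar> * K * b * s2 - \<phi>2 * s2\<^sup>2 \<le> - \<kappa>1 * (b\<^sup>2 + s1\<^sup>2 + s2\<^sup>2)"
    using multipliers_exist[OF \<mu> m Lfh Lh, of K] by blast
  define D where "D = m * K + K\<^sup>2 + K\<^sup>2 / \<mu> + \<gamma> * K\<^sup>2 + K"
  have D: "0 < D"
    unfolding D_def using m K(6) \<mu> \<gamma> by (intro add_nonneg_pos) auto
  define Cr where "Cr = 5 * D\<^sup>2 / \<kappa>0 + D"
  have Cr: "0 < Cr"
    unfolding Cr_def using D \<kappa>0 by (intro add_nonneg_pos) auto
  define \<delta>0 where "\<delta>0 = min (\<mu> * \<gamma>) (min \<kappa>1 1 / 2 / Cr)"
  have "0 < \<delta>0"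
    using \<mu> \<gamma> \<kappa>1 Cr by (simp add: \<delta>0_def)
  moreover have \<delta>0: "\<delta> \<le> \<mu> * \<gamma> \<and> \<delta> * Cr \<le> min \<kappa>1 1 / 2" if "\<delta> \<le> \<delta>0" for \<delta>
    using that Cr by (simp add: \<delta>0_def pos_le_divide_eq)
  moreover have "\<exists>\<kappa>>0. \<forall>u l z1 z2 z3. reduced_supply Pi1 Pi2 Q \<mu> m \<gamma> Lfh Lh \<phi>1 \<phi>2 \<delta> u l z1 z2 z3
      \<le> - \<kappa> * ((norm u)\<^sup>2 + (norm l)\<^sup>2 + (norm z1)\<^sup>2 + (norm z2)\<^sup>2 + (norm z3)\<^sup>2)"
    if \<delta>: "0 < \<delta>" "\<delta> \<le> \<delta>0" for \<delta>
  proof (intro exI conjI allI)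
    show "0 < min (min \<kappa>1 1 / 2) (\<delta> * \<kappa>0 / 2) / (2 + 2 * \<mu>\<^sup>2)"
      using \<kappa>1 \<delta> \<kappa>0 by (simp add: add_pos_nonneg)
    show "reduced_supply Pi1 Pi2 Q \<mu> m \<gamma> Lfh Lh \<phi>1 \<phi>2 \<delta> u l z1 z2 z3
        \<le> - (min (min \<kappa>1 1 / 2) (\<delta> * \<kappa>0 / 2) / (2 + 2 * \<mu>\<^sup>2))
          * ((norm u)\<^sup>2 + (norm l)\<^sup>2 + (norm z1)\<^sup>2 + (norm z2)\<^sup>2 + (norm z3)\<^sup>2)" for u l z1 z2 z3
      by (rule reduced_supply_bound[OF K(1-5) \<mu> _ _ Q \<kappa>0 diag \<kappa>1 D_def D])
        (use \<delta>0[OF \<delta>(2)] \<delta>(1) m \<gamma> in \<open>auto simp: Cr_def\<close>)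
  qed
  ultimately show ?thesis
    using \<phi> by blast
qed

section \<open>The closed loop\<close>

lemma plant_coupling_le:
  fixes T :: "real^'p::finite^'n::finite" and X :: "real^'n^'n" and C1 :: "real^'n^'r1::finite"
    and C2 :: "real^'n^'r2::finite" and Pi1 :: "real^'p^'r1" and Pi2 :: "real^'p^'r2"
  shows "\<exists>Cx. \<forall>(xt::real^'n) (u::real^'p) (z1::real^'p) (z2::real^'r1) (z3::real^'r2).
    (transpose T *v (X *v xt)) \<bullet> (- (m *\<^sub>R u) - z1 - transpose Pi1 *v z2 - (1 / \<mu>) *\<^sub>R (transpose Pi2 *v z3))
      + c * ((C1 *v xt) \<bullet> z2) + (C2 *v xt) \<bullet> z3
    \<le> Cx * norm xt * (norm u + norm z1 + norm z2 + norm z3)"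
proof (intro exI allI)
  define cv where "cv = \<bar>m\<bar> + 1 + onorm ((*v) (transpose Pi1)) + \<bar>1 / \<mu>\<bar> * onorm ((*v) (transpose Pi2))"
  define cx where "cx = onorm ((*v) (transpose T)) * onorm ((*v) X)"
  fix xt :: "real^'n" and u z1 :: "real^'p" and z2 :: "real^'r1" and z3 :: "real^'r2"
  define S where "S = norm u + norm z1 + norm z2 + norm z3"
  have S: "norm u \<le> S" "norm z1 \<le> S" "norm z2 \<le> S" "norm z3 \<le> S"
    unfolding S_def by simp_all
  have "norm (- (m *\<^sub>R u) - z1 - transpose Pi1 *v z2 - (1 / \<mu>) *\<^sub>R (transpose Pi2 *v z3))
      \<le> \<bar>m\<bar> * norm u + norm z1 + onorm ((*v) (transpose Pi1)) * norm z2
        + \<bar>1 / \<mu>\<bar> * (onorm ((*v) (transpose Pi2)) * norm z3)"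
    using norm_diff4_le[of "m *\<^sub>R u" z1 "transpose Pi1 *v z2" "(1 / \<mu>) *\<^sub>R (transpose Pi2 *v z3)"]
      norm_matrix_vector_le_onorm[of "transpose Pi1" z2] norm_matrix_vector_le_onorm[of "transpose Pi2" z3]
      mult_left_mono[OF norm_matrix_vector_le_onorm[of "transpose Pi2" z3], of "\<bar>1 / \<mu>\<bar>"]
    by simp
  also have "\<dots> \<le> cv * S"
  proof -
    have "onorm ((*v) (transpose Pi2)) * norm z3 \<le> onorm ((*v) (transpose Pi2)) * S"
      using S(4) onorm_pos_le[OF matrix_vector_mul_bounded_linear[of "transpose Pi2"]] by (rule mult_left_mono)
    then have "\<bar>1 / \<mu>\<bar> * (onorm ((*v) (transpose Pi2)) * norm z3) \<le> \<bar>1 / \<mu>\<bar> * (onorm ((*v) (transpose Pi2)) * S)"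
      by (rule mult_left_mono) simp
    moreover have "\<bar>m\<bar> * norm u \<le> \<bar>m\<bar> * S"
      using S(1) by (rule mult_left_mono) simp
    moreover have "onorm ((*v) (transpose Pi1)) * norm z2 \<le> onorm ((*v) (transpose Pi1)) * S"
      using S(3) onorm_pos_le[OF matrix_vector_mul_bounded_linear[of "transpose Pi1"]] by (rule mult_left_mono)
    moreover have "cv * S = \<bar>m\<bar> * S + S + onorm ((*v) (transpose Pi1)) * S
        + \<bar>1 / \<mu>\<bar> * (onorm ((*v) (transpose Pi2)) * S)"
      by (simp add: cv_def algebra_simps)
    ultimately show ?thesis
      using S by linarith
  qed
  finally have vv: "norm (- (m *\<^sub>R u) - z1 - transpose Pi1 *v z2 - (1 / \<mu>) *\<^sub>R (transpose Pi2 *v z3))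
      \<le> cv * S" .
  have "norm (transpose T *v (X *v xt)) \<le> onorm ((*v) (transpose T)) * norm (X *v xt)"
    by (rule norm_matrix_vector_le_onorm)
  also have "\<dots> \<le> onorm ((*v) (transpose T)) * (onorm ((*v) X) * norm xt)"
    by (rule mult_left_mono[OF norm_matrix_vector_le_onorm onorm_pos_le[OF matrix_vector_mul_bounded_linear]])
  finally have "norm (transpose T *v (X *v xt)) \<le> cx * norm xt"
    by (simp add: cx_def mult.assoc)
  from abs_inner_le_mult[OF this vv]
  have "(transpose T *v (X *v xt))
      \<bullet> (- (m *\<^sub>R u) - z1 - transpose Pi1 *v z2 - (1 / \<mu>) *\<^sub>R (transpose Pi2 *v z3))
    \<le> (cx * norm xt) * (cv * S)"
    by (rule abs_le_D1)
  moreover have "c * ((C1 *v xt) \<bullet> z2) \<le> \<bar>c\<bar> * (onorm ((*v) C1) * norm xt * S)"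
    by (rule mult_le_abs_mult_of_abs_le[OF abs_inner_le_mult[OF norm_matrix_vector_le_onorm S(3)]])
  moreover have "(C2 *v xt) \<bullet> z3 \<le> onorm ((*v) C2) * norm xt * S"
    by (rule abs_le_D1[OF abs_inner_le_mult[OF norm_matrix_vector_le_onorm S(4)]])
  moreover have "(cx * cv + \<bar>c\<bar> * onorm ((*v) C1) + onorm ((*v) C2)) * norm xt * S
      = (cx * norm xt) * (cv * S) + \<bar>c\<bar> * (onorm ((*v) C1) * norm xt * S) + onorm ((*v) C2) * norm xt * S"
    by (simp add: algebra_simps)
  ultimately show "(transpose T *v (X *v xt))
      \<bullet> (- (m *\<^sub>R u) - z1 - transpose Pi1 *v z2 - (1 / \<mu>) *\<^sub>R (transpose Pi2 *v z3))
      + c * ((C1 *v xt) \<bullet> z2) + (C2 *v xt) \<bullet> z3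
    \<le> (cx * cv + \<bar>c\<bar> * onorm ((*v) C1) + onorm ((*v) C2)) * norm xt * S"
    by linarith
qed

lemma lmi_form_nonpos:
  fixes A :: "real^'n::finite^'n" and B T :: "real^'p::finite^'n" and C1 :: "real^'n^'r1::finite"
    and C2 :: "real^'n^'r2::finite" and Pi1 :: "real^'p^'r1" and Pi2 :: "real^'p^'r2" and X :: "real^'n^'n"
    and Q :: "real^'r2^'r2" and \<xi> :: "real^('n + 'p + 'r2)" and \<zeta> :: "real^('p + 'r1 + 'r2)"
  assumes AT: "A ** T = B" and Pi1: "Pi1 = - (C1 ** T)" and Pi2: "Pi2 = - (C2 ** T)"
    and X: "transpose X = X" "\<And>x. (norm x)\<^sup>2 \<le> x \<bullet> (X *v x)"
    and XA: "\<And>x. x \<bullet> (X *v (A *v x)) \<le> - \<kappa>X * (norm x)\<^sup>2"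
    and \<mu>: "0 < \<mu>" and \<delta>: "0 \<le> \<delta>" "\<delta> * onorm ((*v) Pi2) \<le> \<mu> / 2" and \<epsilon>: "0 < \<epsilon>" and \<rho>: "0 \<le> \<rho>"
    and reduced: "\<And>u l z1 z2 z3. reduced_supply Pi1 Pi2 Q \<mu> m \<gamma> Lfh Lh \<phi>1 \<phi>2 \<delta> u l z1 z2 z3
      \<le> - \<kappa> * ((norm u)\<^sup>2 + (norm l)\<^sup>2 + (norm z1)\<^sup>2 + (norm z2)\<^sup>2 + (norm z3)\<^sup>2)"
    and coupling: "\<And>xt u z1 z2 z3. (transpose T *v (X *v xt))
        \<bullet> (- (m *\<^sub>R u) - z1 - transpose Pi1 *v z2 - (1 / \<mu>) *\<^sub>R (transpose Pi2 *v z3))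
      + \<phi>2 * Lh * ((C1 *v xt) \<bullet> z2) + (C2 *v xt) \<bullet> z3
      \<le> Cx * norm xt * (norm u + norm z1 + norm z2 + norm z3)"
    and margin: "\<And>a S W. S\<^sup>2 \<le> 4 * W \<Longrightarrow>
      \<rho> * (onorm ((*v) X) + 3 / 2 * \<mu>) * (a\<^sup>2 + W) - \<kappa>X / \<epsilon> * a\<^sup>2 + Cx * a * S - \<kappa> * W \<le> 0"
  shows "2 * ((lmi_certificate X T Pi2 \<mu> \<delta> *v \<xi>) \<bullet> (AA_rho A B m \<mu> Q \<gamma> \<epsilon> \<rho> *v \<xi> + BB Pi1 Pi2 \<mu> *v \<zeta>))
    + join_vec (CC C1 C2 \<mu> *v \<xi>) \<zeta> \<bullet> (Xi Lfh Lh \<phi>1 \<phi>2 *v join_vec (CC C1 C2 \<mu> *v \<xi>) \<zeta>) \<le> 0"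
proof -
  obtain x u l where \<xi>: "\<xi> = join_vec x (join_vec u l)"
    by (metis join_vec_cases)
  obtain z1 z2 z3 where \<zeta>: "\<zeta> = join_vec z1 (join_vec z2 z3)"
    by (metis join_vec_cases)
  define W where "W = (norm u)\<^sup>2 + (norm l)\<^sup>2 + (norm z1)\<^sup>2 + (norm z2)\<^sup>2 + (norm z3)\<^sup>2"
  define S where "S = norm u + norm z1 + norm z2 + norm z3"
  define Cv where "Cv = onorm ((*v) X) + 3 / 2 * \<mu>"
  have "\<xi> \<bullet> (lmi_certificate X T Pi2 \<mu> \<delta> *v \<xi>) \<le> Cv * ((norm (x + T *v u))\<^sup>2 + (norm u)\<^sup>2 + (norm l)\<^sup>2)"
    unfolding \<xi> Cv_def by (rule lmi_certificate_bounds(2)[OF X \<delta>])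
  also have "\<dots> \<le> Cv * ((norm (x + T *v u))\<^sup>2 + W)"
    using \<mu> onorm_pos_le[OF matrix_vector_mul_bounded_linear[of X]]
    by (intro mult_left_mono) (auto simp: Cv_def W_def)
  finally have "\<rho> * (\<xi> \<bullet> (lmi_certificate X T Pi2 \<mu> \<delta> *v \<xi>)) \<le> \<rho> * (Cv * ((norm (x + T *v u))\<^sup>2 + W))"
    using \<rho> by (rule mult_left_mono)
  then have V: "\<rho> * (\<xi> \<bullet> (lmi_certificate X T Pi2 \<mu> \<delta> *v \<xi>)) \<le> \<rho> * Cv * ((norm (x + T *v u))\<^sup>2 + W)"
    by (simp only: mult.assoc)
  have E: "(X *v (x + T *v u)) \<bullet> (A *v (x + T *v u)) / \<epsilon> \<le> - (\<kappa>X / \<epsilon> * (norm (x + T *v u))\<^sup>2)"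
    using divide_right_mono[OF XA[of "x + T *v u"], of \<epsilon>] \<epsilon>
      inner_symmetric_matrix[OF X(1), of "x + T *v u" "A *v (x + T *v u)"]
    by (simp add: inner_commute)
  have R: "reduced_supply Pi1 Pi2 Q \<mu> m \<gamma> Lfh Lh \<phi>1 \<phi>2 \<delta> u l z1 z2 z3 \<le> - (\<kappa> * W)"
    using reduced[of u l z1 z2 z3] unfolding W_def by simp
  have G: "(transpose T *v (X *v (x + T *v u)))
        \<bullet> (- (m *\<^sub>R u) - z1 - transpose Pi1 *v z2 - (1 / \<mu>) *\<^sub>R (transpose Pi2 *v z3))
      + \<phi>2 * Lh * ((C1 *v (x + T *v u)) \<bullet> z2) + (C2 *v (x + T *v u)) \<bullet> z3
      \<le> Cx * norm (x + T *v u) * S"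
    unfolding S_def by (rule coupling)
  have "2 * ((lmi_certificate X T Pi2 \<mu> \<delta> *v \<xi>) \<bullet> (AA_rho A B m \<mu> Q \<gamma> \<epsilon> \<rho> *v \<xi> + BB Pi1 Pi2 \<mu> *v \<zeta>))
      + join_vec (CC C1 C2 \<mu> *v \<xi>) \<zeta> \<bullet> (Xi Lfh Lh \<phi>1 \<phi>2 *v join_vec (CC C1 C2 \<mu> *v \<xi>) \<zeta>)
    \<le> 2 * (\<rho> * Cv * ((norm (x + T *v u))\<^sup>2 + W) + - (\<kappa>X / \<epsilon> * (norm (x + T *v u))\<^sup>2)
      + Cx * norm (x + T *v u) * S + - (\<kappa> * W))"
    unfolding \<xi> \<zeta> lmi_form_decomposition[OF AT Pi1 Pi2 X(1) \<mu>[THEN less_imp_neq, symmetric]]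
    by (intro mult_left_mono add_mono E G R V[unfolded \<xi>]) simp_all
  also have "\<dots> \<le> 0"
  proof -
    have "S\<^sup>2 \<le> 4 * ((norm u)\<^sup>2 + (norm z1)\<^sup>2 + (norm z2)\<^sup>2 + (norm z3)\<^sup>2)"
      unfolding S_def by (rule square_sum4_le)
    also have "\<dots> \<le> 4 * W"
      unfolding W_def by simp
    finally show ?thesis
      using margin[of S W "norm (x + T *v u)"] unfolding Cv_def by simp
  qed
  finally show ?thesis .
qed

lemma regularized_lmi_feasible:
  fixes A :: "real^'n::finite^'n" and B T :: "real^'p::finite^'n" and C1 :: "real^'n^'r1::finite"
    and C2 :: "real^'n^'r2::finite" and Pi1 :: "real^'p^'r1" and Pi2 :: "real^'p^'r2" and X :: "real^'n^'n"
    and Q :: "real^'r2^'r2"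
  assumes AT: "A ** T = B" and Pi1: "Pi1 = - (C1 ** T)" and Pi2: "Pi2 = - (C2 ** T)"
    and X: "transpose X = X" "\<And>x. (norm x)\<^sup>2 \<le> x \<bullet> (X *v x)"
    and XA: "\<And>x. x \<bullet> (X *v (A *v x)) \<le> - \<kappa>X * (norm x)\<^sup>2" and \<kappa>X: "0 < \<kappa>X"
    and \<mu>: "0 < \<mu>" and m: "0 < m" and \<gamma>: "0 < \<gamma>" and Q: "psd Q"
    and kernel: "\<forall>l. transpose Pi2 *v l = 0 \<and> Q *v l = 0 \<longrightarrow> l = 0"
    and Lfh: "- m < Lfh" and Lh: "0 \<le> Lh"
  shows "\<exists>\<epsilon>>0. \<exists>\<rho>>0. \<exists>\<phi>1\<ge>0. \<exists>\<phi>2\<ge>0. \<exists>P. pd P \<and>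
    LMI (AA_rho A B m \<mu> Q \<gamma> \<epsilon> \<rho>) (BB Pi1 Pi2 \<mu> :: real^('p + 'r1 + 'r2)^('n + 'p + 'r2))
      (CC C1 C2 \<mu>) P (Xi Lfh Lh \<phi>1 \<phi>2)"
proof -
  obtain \<phi>1 \<phi>2 \<delta>0 where \<phi>: "0 \<le> \<phi>1" "0 \<le> \<phi>2" and "0 < \<delta>0"
    and reduced: "\<forall>\<delta>. 0 < \<delta> \<and> \<delta> \<le> \<delta>0 \<longrightarrow> (\<exists>\<kappa>>0. \<forall>u l z1 z2 z3.
      reduced_supply Pi1 Pi2 Q \<mu> m \<gamma> Lfh Lh \<phi>1 \<phi>2 \<delta> u l z1 z2 z3
        \<le> - \<kappa> * ((norm u)\<^sup>2 + (norm l)\<^sup>2 + (norm z1)\<^sup>2 + (norm z2)\<^sup>2 + (norm z3)\<^sup>2))"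
    using reduced_supply_negative[OF \<mu> m \<gamma> Q kernel Lfh Lh, where ?Pi1.0 = Pi1] by (elim exE conjE) (rule that; assumption)
  have "0 < \<mu> / 2"
    using \<mu> by simp
  then obtain \<delta> where \<delta>: "0 < \<delta>" "\<delta> \<le> \<delta>0" and \<delta>Pi2: "\<delta> * onorm ((*v) Pi2) \<le> \<mu> / 2"
    using exists_pos_le_mult_le[OF \<open>0 < \<delta>0\<close> _ onorm_pos_le[OF matrix_vector_mul_bounded_linear]] by blast
  obtain \<kappa> where \<kappa>: "0 < \<kappa>" and red: "\<forall>u l z1 z2 z3.
      reduced_supply Pi1 Pi2 Q \<mu> m \<gamma> Lfh Lh \<phi>1 \<phi>2 \<delta> u l z1 z2 z3
        \<le> - \<kappa> * ((norm u)\<^sup>2 + (norm l)\<^sup>2 + (norm z1)\<^sup>2 + (norm z2)\<^sup>2 + (norm z3)\<^sup>2)"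
    using reduced \<delta>(1,2) by blast
  obtain Cx where coupling: "\<forall>(xt::real^'n) (u::real^'p) (z1::real^'p) (z2::real^'r1) (z3::real^'r2).
      (transpose T *v (X *v xt)) \<bullet> (- (m *\<^sub>R u) - z1 - transpose Pi1 *v z2 - (1 / \<mu>) *\<^sub>R (transpose Pi2 *v z3))
      + \<phi>2 * Lh * ((C1 *v xt) \<bullet> z2) + (C2 *v xt) \<bullet> z3
      \<le> Cx * norm xt * (norm u + norm z1 + norm z2 + norm z3)"
    using plant_coupling_le[where T = T and X = X and ?C1.0 = C1 and ?C2.0 = C2 and ?Pi1.0 = Pi1
        and ?Pi2.0 = Pi2 and m = m and \<mu> = \<mu> and c = "\<phi>2 * Lh"] by blast
  have "0 \<le> onorm ((*v) X) + 3 / 2 * \<mu>"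
    using \<mu> onorm_pos_le[OF matrix_vector_mul_bounded_linear[of X]] by simp
  from singular_perturbation_margin[OF \<kappa>X \<kappa> this, where Cx = Cx]
  obtain \<epsilon> \<rho> where \<epsilon>\<rho>: "0 < \<epsilon>" "0 < \<rho>" and margin: "\<forall>a S W. S\<^sup>2 \<le> 4 * W \<longrightarrow>
      \<rho> * (onorm ((*v) X) + 3 / 2 * \<mu>) * (a\<^sup>2 + W) - \<kappa>X / \<epsilon> * a\<^sup>2 + Cx * a * S - \<kappa> * W \<le> 0"
    by blast
  have pd: "pd (lmi_certificate X T Pi2 \<mu> \<delta>)"
    using pd_lmi_certificate[OF X \<mu> _ \<delta>Pi2] \<delta>(1) by simp
  then have "transpose (lmi_certificate X T Pi2 \<mu> \<delta>) = lmi_certificate X T Pi2 \<mu> \<delta>"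
    unfolding pd_def ..
  then have "LMI (AA_rho A B m \<mu> Q \<gamma> \<epsilon> \<rho>) (BB Pi1 Pi2 \<mu> :: real^('p + 'r1 + 'r2)^('n + 'p + 'r2))
      (CC C1 C2 \<mu>) (lmi_certificate X T Pi2 \<mu> \<delta>) (Xi Lfh Lh \<phi>1 \<phi>2)"
    using symmetric_Xi lmi_form_nonpos[OF AT Pi1 Pi2 X XA \<mu> less_imp_le[OF \<delta>(1)] \<delta>Pi2 \<epsilon>\<rho>(1)
        less_imp_le[OF \<epsilon>\<rho>(2)] red[rule_format] coupling[rule_format] margin[rule_format]]
    by (rule LMI_of_quadratic_form)
  with pd \<epsilon>\<rho> \<phi> show ?thesis
    by blast
qed

section \<open>Strongly convex functions\<close>

lemma lipschitz_gradient_nonneg: "lipschitz_gradient L f \<Longrightarrow> 0 \<le> L"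
  unfolding lipschitz_gradient_def lipschitz_on_def by auto

text \<open>A function whose gradient is \<open>0\<close>-Lipschitz is affine, hence not strongly convex.\<close>

lemma lipschitz_gradient_pos_if_strongly_convex:
  fixes f :: "real^'p::finite \<Rightarrow> real"
  assumes sc: "strongly_convex m f" and lg: "lipschitz_gradient L f" and m: "0 < m"
  shows "0 < L"
proof (rule ccontr)
  assume "\<not> 0 < L"
  with lipschitz_gradient_nonneg[OF lg] have L0: "L = 0"
    by simp
  from lg obtain Df where der: "\<And>x. (f has_derivative (\<lambda>v. Df x \<bullet> v)) (at x)"
    and lip: "L-lipschitz_on UNIV Df"
    unfolding lipschitz_gradient_def by blast
  have Dc: "Df x = Df 0" for x
    using lip L0 unfolding lipschitz_on_def by auto
  define g where "g x = f x - Df 0 \<bullet> x" for x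
  have "(g has_derivative (\<lambda>h. 0)) (at x within UNIV)" for x
  proof -
    have "(g has_derivative (\<lambda>v. Df x \<bullet> v - Df 0 \<bullet> v)) (at x)"
      unfolding g_def by (intro derivative_intros der)
    then show ?thesis
      using Dc[of x] by simp
  qed
  then obtain k where "\<And>x. g x = k"
    using has_derivative_zero_constant[of UNIV g] by auto
  then have affine: "f x = k + Df 0 \<bullet> x" for x
    unfolding g_def by (metis diff_add_cancel)
  define e :: "real^'p" where "e = 1"
  have "e \<noteq> 0"
    unfolding e_def by (simp add: Finite_Cartesian_Product.vec_eq_iff)
  have "f ((1/2) *\<^sub>R e + (1 - 1/2) *\<^sub>R 0)
      \<le> (1/2) * f e + (1 - 1/2) * f 0 - m / 2 * (1/2) * (1 - 1/2) * (norm (e - 0))\<^sup>2"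
    by (rule sc[unfolded strongly_convex_def, rule_format]) simp_all
  then have "m / 8 * (norm e)\<^sup>2 \<le> 0"
    unfolding affine by (simp add: algebra_simps)
  moreover have "0 < m / 8 * (norm e)\<^sup>2"
    using m \<open>e \<noteq> 0\<close> by simp
  ultimately show False
    by simp
qed

theorem theorem3:
  fixes A :: "real^'n^'n" and B :: "real^'p^'n" and Bw :: "real^'q^'n"
    and C1 :: "real^'n^'r1" and D1w :: "real^'q^'r1"
    and C2 :: "real^'n^'r2" and D2w :: "real^'q^'r2"
    and f :: "real \<Rightarrow> real^'p \<Rightarrow> real"
    and h :: "real \<Rightarrow> real^'r1 \<Rightarrow> real"
    and g :: "real \<Rightarrow> real^'r2 \<Rightarrow> ereal"
    and w :: "real \<Rightarrow> real^'q"
    and \<mu> m Lf Lh :: real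
    and Q :: "real^'r2^'r2"
  defines "Pi1u \<equiv> Pi_u C1 A B" and "Pi2u \<equiv> Pi_u C2 A B"
    and "Pi1w \<equiv> Pi_w C1 A Bw D1w" and "Pi2w \<equiv> Pi_w C2 A Bw D2w"
  assumes hurwitz: "hurwitz A"
    and mu_pos: "0 < \<mu>"
    \<comment> \<open>Assumption 1\<close>
    and m_pos: "0 < m"
    and f_sc: "\<forall>t\<ge>0. strongly_convex m (f t)"
    and f_grad: "\<forall>t\<ge>0. lipschitz_gradient Lf (f t)"
    and h_cvx: "\<forall>t\<ge>0. convex_on UNIV (h t)"
    and h_grad: "\<forall>t\<ge>0. lipschitz_gradient Lh (h t)"
    and g_cvx: "\<forall>t\<ge>0. proper_fun (g t) \<and> ext_convex (g t) \<and> lsc (g t)"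
    \<comment> \<open>Assumption 2\<close>
    and feas: "\<forall>t\<ge>0. feasible f h g w Pi1u Pi1w Pi2u Pi2w t"
    and opt: "\<exists>(us :: real \<Rightarrow> real^'p) (ls :: real \<Rightarrow> real^'r2).
               (\<lambda>t. (us t, ls t)) \<in> borel_measurable (restrict_space borel {0..}) \<and>
               (\<forall>t\<ge>0. \<forall>u l.
                  saddle_fun f h g w Pi1u Pi1w Pi2u Pi2w \<mu> t (us t) l
                    \<le> saddle_fun f h g w Pi1u Pi1w Pi2u Pi2w \<mu> t (us t) (ls t) \<and>
                  saddle_fun f h g w Pi1u Pi1w Pi2u Pi2w \<mu> t (us t) (ls t)
                    \<le> saddle_fun f h g w Pi1u Pi1w Pi2u Pi2w \<mu> t u (ls t))"
    \<comment> \<open>hypotheses of the theorem\<close>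
    and Q_psd: "psd Q"
    and null_cond: "{x. (Pi2u ** transpose Pi2u) *v x = 0} \<inter> {x. Q *v x = 0} = {0}"
    and mu_ge: "max (Lf - m) Lh \<le> \<mu>"
  shows "\<forall>\<gamma>>0. \<exists>\<epsilon>>0. \<exists>\<rho>>0. \<exists>\<phi>1\<ge>0. \<exists>\<phi>2\<ge>0. \<exists>P.
           pd P \<and>
           LMI (AA_rho A B m \<mu> Q \<gamma> \<epsilon> \<rho>) (BB Pi1u Pi2u \<mu> :: real^('p + 'r1 + 'r2)^('n + 'p + 'r2))
               (CC C1 C2 \<mu>) P (Xi (Lf - m) Lh \<phi>1 \<phi>2)"
proof (intro allI impI)
  fix \<gamma> :: real
  assume \<gamma>: "0 < \<gamma>"
  define T where "T = matrix_inv A ** B"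
  have AT: "A ** T = B"
    using hurwitz_right_inverse[OF hurwitz] by (simp add: T_def matrix_mul_assoc)
  have Pi1: "Pi1u = - (C1 ** T)" and Pi2: "Pi2u = - (C2 ** T)"
    by (simp_all add: Pi1u_def Pi2u_def Pi_u_def T_def matrix_mul_assoc)
  obtain X \<kappa>X where X: "transpose X = X" "\<And>x. (norm x)\<^sup>2 \<le> x \<bullet> (X *v x)" and "0 < \<kappa>X"
    and XA: "\<And>x. x \<bullet> (X *v (A *v x)) \<le> - \<kappa>X * (norm x)\<^sup>2"
    using hurwitz_lyapunov[OF hurwitz] by blast
  have "\<forall>l. transpose Pi2u *v l = 0 \<and> Q *v l = 0 \<longrightarrow> l = 0"
    by (rule kernel_transpose_inter_trivial[OF null_cond])
  moreover have "- m < Lf - m"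
    using lipschitz_gradient_pos_if_strongly_convex[of m "f 0" Lf] f_sc f_grad m_pos by simp
  moreover have "0 \<le> Lh"
    using lipschitz_gradient_nonneg h_grad by blast
  ultimately show "\<exists>\<epsilon>>0. \<exists>\<rho>>0. \<exists>\<phi>1\<ge>0. \<exists>\<phi>2\<ge>0. \<exists>P. pd P \<and>
      LMI (AA_rho A B m \<mu> Q \<gamma> \<epsilon> \<rho>) (BB Pi1u Pi2u \<mu> :: real^('p + 'r1 + 'r2)^('n + 'p + 'r2))
        (CC C1 C2 \<mu>) P (Xi (Lf - m) Lh \<phi>1 \<phi>2)"
    by (rule regularized_lmi_feasible[OF AT Pi1 Pi2 X XA \<open>0 < \<kappa>X\<close> mu_pos m_pos \<gamma> Q_psd])
qed

end
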